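(* There exists a universal constant $c>0$ such that the following holds. Let $\mathcal M=\mathcal M(C_\rho,\{\rho_t\}_{t\in[N]},\{n_t\}_{t\in[N+1]},C_\beta,\beta)$ be any multisource class with $\beta=1$, let $\Pi\in\mathcal M$, let $\hat h_Z$ denote the ERM over (all the data in) $Z\sim\Pi$, and let $\delta\in(0,1)$. With probability at least $1-\delta$, $$\mathcal E_{\mathcal D}(\hat h_Z)\le\min_{t\in[N+1]}C_\rho\left(c\,C_\beta\,\frac{d_{\mathcal H}\log\!\big(\frac1{d_{\mathcal H}}\sum_{s=1}^{N+1}n_s\big)+\log(1/\delta)}{\sum_{s=1}^t n_{(s)}}\right)^{1/\bar\rho_t}.$$
   Context: Setting: $\mathcal X$ is an instance space, $\mathcal Y=\{-1,1\}$, and $\mathcal H$ is a fixed class of classifiers $h:\mathcal X\to\mathcal Y$ with finite VC dimension $d_{\mathcal H}$ and $|\mathcal H|\ge 3$. For a distribution $P$ on $\mathcal X\times\mathcal Y$: $R_P(h)=P(h(X)\ne Y)$, $\mathcal E_P(h)=R_P(h)-\inf_{h'\in\mathcal H}R_P(h')$, $P(h\ne h')=P_X(h(X)\neq h'(X))$, and $h^*_P\in\arg\min_{h\in\mathcal H}R_P(h)$ is assumed to exist. Bernstein class condition with parameters $(C_\beta,\beta)$, $\beta\in[0,1]$, $C_\beta\ge2$: $P(h\ne h_P^* )\le C_\beta\,\mathcal E_P^\beta(h)$ for all $h\in\mathcal H$. Transfer exponent: for $\rho\in(0,\infty]$, $C_\rho\ge 2$, $P$ has transfer exponent $(C_\rho,\rho)$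 w.r.t. $\mathcal D$ if $\mathcal E_{\mathcal D}(h)\le C_\rho\,\mathcal E_P^{1/\rho}(h)$ for all $h\in\mathcal H$ (always true for $\rho=\infty$). Multisource class $\mathcal M(C_\rho,\{\rho_t\}_{t\in[N]},\{n_t\}_{t\in[N+1]},C_\beta,\beta)$: all product distributions $\Pi=\prod_{t\in[N]}P_t^{n_t}\times\mathcal D^{n_{\mathcal D}}$, $n_t\ge1$ for $t\in[N]$, $n_{\mathcal D}=n_{N+1}\ge0$, with (A1) some $h^*\in\mathcal H$ minimizes $R_{P_t}$ over $\mathcal H$ for every $t\in[N+1]$, where $P_{N+1}=\mathcal D$; (A2) each source $P_t$, $t\in[N]$, has transfer exponent $(C_\rho,\rho_t)$ w.r.t. the target $\mathcal D$; (A3) all $P_t$, $t\in[N+1]$, satisfy the Bernstein class condition with $(C_\beta,\beta)$. Set $\rho_{N+1}=1$. $\mathcal D$ always denotes the target of the current $\Pi$. $Z=\{Z_t\}_{t\in[N+1]}\sim\Pi$, $|Z_t|=n_t$. The ERM over a dataset $S$ is an element of $\arg\min_{h\in\mathcal H}\hat R_S(h)$, $\hat R_S(h)=\frac1{|S|}\sum_{(x,y)\in S}\mathbf 1\{h(x)\ne y\}$; $\hat h_Z$ is the ERM over $\bigcup_{t\in[N+1]}Z_t$. Order statistics: $\rho_{(1)}\le\dots\le\rho_{(N+1)}$ are the sorted values of $\rho_t$, $t\in[N+1]$, and $n_{(t)}$ is the sample size at index $(t)$. $\bar\rho_t=\sum_{s\in[t]}\alpha_{(s)}\rho_{(s)}$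 with $\alpha_{(s)}=n_{(s)}/\sum_{r\in[t]}n_{(r)}$. $\log(x)=\max\{\ln x,1\}$ for $x\ge0$. Convention $1/0=\infty$ (a term with $\sum_{s\le t}n_{(s)}=0$ is $+\infty$) and $1/\infty=0$. $[k]=\{1,\dots,k\}$.
   Formalization: Assumes the sets of instance tuples on which H realises a given label pattern are universally measurable (the claim fails for initial segments of ω₁); c is stated for all spaces within one carrier type, uniformity over all spaces following by a disjoint-union argument. *)

theory Defs
  imports "HOL-Probability.Probability"
begin

abbreviation labels :: "int set" where
  "labels \<equiv> {-1, 1}"

text \<open>The instance space is a measurable space \<open>X\<close>; laws of labelled points live on this space.\<close>

abbreviation labelled :: "'x measure \<Rightarrow> ('x \<times> int) measure" where
  "labelled X \<equiv> X \<Otimes>\<^sub>M count_space labels"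

text \<open>
  For an arbitrary class of measurable classifiers, uniform convergence can fail although the VC
  dimension is finite (initial segments of an uncountable well-order, with the
  countable-cocountable measure). The following regularity condition excludes this: the set
  of \<open>m\<close>-tuples of instances on which \<open>H\<close> realises a given label pattern is universally measurable.
  It holds if \<open>H\<close> is countable, if \<open>X\<close> is countable and discrete, if \<open>H\<close> has a countable
  subset from which every member is a pointwise limit, and if \<open>H\<close> is image admissible Suslin.
\<close>

definition universally_measurable_traces :: "'x measure \<Rightarrow> ('x \<Rightarrow> int) set \<Rightarrow> bool" where
  "universally_measurable_traces X H \<longleftrightarrow>
     (\<forall>m::nat. \<forall>v \<in> {..<m} \<rightarrow> labels. \<forall>Q.
        prob_space Q \<and> sets Q = sets (\<Pi>\<^sub>M i\<in>{..<m}. X) \<longrightarrow>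
        {x \<in> space (\<Pi>\<^sub>M i\<in>{..<m}. X). \<exists>h\<in>H. \<forall>i<m. h (x i) = v i} \<in> sets (completion Q))"

text \<open>
  Classifiers are extensional functions, so that two members of \<open>H\<close> which agree on the
  instance space are equal and do not contribute twice to its cardinality.
\<close>

definition classifier_class :: "'x measure \<Rightarrow> ('x \<Rightarrow> int) set \<Rightarrow> bool" where
  "classifier_class X H \<longleftrightarrow>
     H \<subseteq> (space X \<rightarrow>\<^sub>E labels) \<and> H \<subseteq> measurable X (count_space labels) \<and>
     (\<exists>F\<subseteq>H. card F = 3) \<and> universally_measurable_traces X H"

definition shatters :: "('x \<Rightarrow> int) set \<Rightarrow> 'x set \<Rightarrow> bool" where
  "shatters H S \<longleftrightarrow> (\<forall>v \<in> S \<rightarrow> labels. \<exists>h\<in>H. \<forall>x\<in>S. h x = v x)"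

definition vc_dim :: "'x measure \<Rightarrow> ('x \<Rightarrow> int) set \<Rightarrow> enat" where
  "vc_dim X H = (SUP S \<in> {S. S \<subseteq> space X \<and> finite S \<and> shatters H S}. enat (card S))"

definition risk :: "('x \<times> int) measure \<Rightarrow> ('x \<Rightarrow> int) \<Rightarrow> real" where
  "risk P h = measure P {z \<in> space P. h (fst z) \<noteq> snd z}"

definition excess_risk ::
    "('x \<Rightarrow> int) set \<Rightarrow> ('x \<times> int) measure \<Rightarrow> ('x \<Rightarrow> int) \<Rightarrow> real" where
  "excess_risk H P h = risk P h - (INF h'\<in>H. risk P h')"

definition disagreement ::
    "'x measure \<Rightarrow> ('x \<times> int) measure \<Rightarrow> ('x \<Rightarrow> int) \<Rightarrow> ('x \<Rightarrow> int) \<Rightarrow> real" where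
  "disagreement X P h h' = measure (distr P X fst) {x \<in> space X. h x \<noteq> h' x}"

text \<open>\<open>I\<close> indexes the data points, so repeated observations are counted with multiplicity.\<close>

definition empirical_risk :: "'i set \<Rightarrow> ('i \<Rightarrow> 'x \<times> int) \<Rightarrow> ('x \<Rightarrow> int) \<Rightarrow> real" where
  "empirical_risk I z h = real (card {i \<in> I. h (fst (z i)) \<noteq> snd (z i)}) / real (card I)"

definition is_erm ::
    "('x \<Rightarrow> int) set \<Rightarrow> 'i set \<Rightarrow> ('i \<Rightarrow> 'x \<times> int) \<Rightarrow> ('x \<Rightarrow> int) \<Rightarrow> bool" where
  "is_erm H I z h \<longleftrightarrow> is_arg_min (empirical_risk I z) (\<lambda>h'. h' \<in> H) h"

text \<open>In contrast to \<open>powr\<close>, \<open>0\<close> to the power \<open>0\<close> is \<open>1\<close>.\<close>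

definition rpow :: "real \<Rightarrow> real \<Rightarrow> real" where
  "rpow x a = (if a = 0 then 1 else x powr a)"

definition bernstein_class ::
    "'x measure \<Rightarrow> ('x \<Rightarrow> int) set \<Rightarrow> ('x \<times> int) measure \<Rightarrow> real \<Rightarrow> real \<Rightarrow> bool" where
  "bernstein_class X H P C\<beta> \<beta> \<longleftrightarrow>
     (\<exists>hs. is_arg_min (risk P) (\<lambda>h. h \<in> H) hs \<and>
        (\<forall>h\<in>H. disagreement X P h hs \<le> C\<beta> * rpow (excess_risk H P h) \<beta>))"

definition transfer_exponent ::
    "('x \<Rightarrow> int) set \<Rightarrow> ('x \<times> int) measure \<Rightarrow> ('x \<times> int) measure \<Rightarrow> real \<Rightarrow> ereal \<Rightarrow> bool" where
  "transfer_exponent H P D C\<rho> \<rho> \<longleftrightarrow>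
     (\<forall>h\<in>H. excess_risk H D h \<le> C\<rho> * rpow (excess_risk H P h) (real_of_ereal (1 / \<rho>)))"

text \<open>
  A member of the multisource class is given by its marginals \<open>P 1, \<dots>, P N\<close> (sources) and
  \<open>P (N + 1)\<close> (target), since the product law does not determine the target if \<open>n (N + 1) = 0\<close>.
\<close>

definition multisource_class ::
    "'x measure \<Rightarrow> ('x \<Rightarrow> int) set \<Rightarrow> nat \<Rightarrow> real \<Rightarrow> (nat \<Rightarrow> ereal) \<Rightarrow> (nat \<Rightarrow> nat) \<Rightarrow> real \<Rightarrow> real \<Rightarrow>
     (nat \<Rightarrow> ('x \<times> int) measure) set" where
  "multisource_class X H N C\<rho> \<rho> n C\<beta> \<beta> =
     {P. C\<rho> \<ge> 2 \<and> C\<beta> \<ge> 2 \<and> 0 \<le> \<beta> \<and> \<beta> \<le> 1 \<and>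
         (\<forall>t\<in>{1..N}. n t \<ge> 1 \<and> \<rho> t > 0) \<and>
         (\<forall>t\<in>{1..N+1}. prob_space (P t) \<and> sets (P t) = sets (labelled X)) \<and>
         (\<exists>hs. \<forall>t\<in>{1..N+1}. is_arg_min (risk (P t)) (\<lambda>h. h \<in> H) hs) \<and>
         (\<forall>t\<in>{1..N}. transfer_exponent H (P t) (P (N+1)) C\<rho> (\<rho> t)) \<and>
         (\<forall>t\<in>{1..N+1}. bernstein_class X H (P t) C\<beta> \<beta>)}"

text \<open>\<open>(t, i)\<close> is the index of the \<open>i\<close>-th data point drawn from \<open>P t\<close>.\<close>

definition sample_index :: "nat \<Rightarrow> (nat \<Rightarrow> nat) \<Rightarrow> (nat \<times> nat) set" where
  "sample_index N n = (SIGMA t:{1..N+1}. {1..n t})"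

definition sample_law ::
    "nat \<Rightarrow> (nat \<Rightarrow> nat) \<Rightarrow> (nat \<Rightarrow> ('x \<times> int) measure) \<Rightarrow> (nat \<times> nat \<Rightarrow> 'x \<times> int) measure" where
  "sample_law N n P = (\<Pi>\<^sub>M ti\<in>sample_index N n. P (fst ti))"

text \<open>
  The empirical risk minimiser need not be measurable, so an event has probability at least
  \<open>p\<close> if it contains a measurable event of probability at least \<open>p\<close>.
\<close>

definition with_prob_at_least :: "'a measure \<Rightarrow> real \<Rightarrow> ('a \<Rightarrow> bool) \<Rightarrow> bool" where
  "with_prob_at_least M p E \<longleftrightarrow> (\<exists>A\<in>sets M. (\<forall>\<omega>\<in>A. E \<omega>) \<and> measure M A \<ge> p)"

text \<open>Ties between equal exponents may be broken arbitrarily by \<open>\<sigma>\<close>.\<close>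

definition sorting_perm :: "nat \<Rightarrow> (nat \<Rightarrow> ereal) \<Rightarrow> (nat \<Rightarrow> nat) \<Rightarrow> bool" where
  "sorting_perm N \<rho> \<sigma> \<longleftrightarrow>
     bij_betw \<sigma> {1..N+1} {1..N+1} \<and> mono_on {1..N+1} (\<lambda>s. \<rho> (\<sigma> s))"

definition avg_exponent ::
    "(nat \<Rightarrow> ereal) \<Rightarrow> (nat \<Rightarrow> nat) \<Rightarrow> (nat \<Rightarrow> nat) \<Rightarrow> nat \<Rightarrow> ereal" where
  "avg_exponent \<rho> n \<sigma> t =
     (\<Sum>s\<in>{1..t}. ereal (real (n (\<sigma> s)) / real (\<Sum>r\<in>{1..t}. n (\<sigma> r))) * \<rho> (\<sigma> s))"

definition log1 :: "real \<Rightarrow> real" where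
  "log1 x = max (ln x) 1"

definition rate ::
    "real \<Rightarrow> nat \<Rightarrow> real \<Rightarrow> nat \<Rightarrow> real \<Rightarrow> (nat \<Rightarrow> ereal) \<Rightarrow> (nat \<Rightarrow> nat) \<Rightarrow> real \<Rightarrow> (nat \<Rightarrow> nat) \<Rightarrow>
     nat \<Rightarrow> ereal" where
  "rate c d \<delta> N C\<rho> \<rho> n C\<beta> \<sigma> t =
     (if (\<Sum>s\<in>{1..t}. n (\<sigma> s)) = 0 then \<infinity>
      else ereal (C\<rho> * rpow
        (c * C\<beta> *
          ((real d * log1 (1 / real d * real (\<Sum>s\<in>{1..N+1}. n s)) + log1 (1 / \<delta>))
            / real (\<Sum>s\<in>{1..t}. n (\<sigma> s))))
        (real_of_ereal (1 / avg_exponent \<rho> n \<sigma> t))))"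

end

theory Submission
  imports Defs
begin

text \<open>
  The cumulative excess risk \<open>\<Sum>i. risk (M i) h - risk (M i) hs\<close> over all data points is bounded
  by \<open>400 C (d log (n / d) + log (1 / \<delta>))\<close> for every \<open>h\<close> whose empirical risk is at most
  that of the common minimiser \<open>hs\<close>; dropping the terms beyond the \<open>t\<close> smallest transfer exponents
  and applying the transfer exponents with Jensen's inequality yields every term of the minimum.

  The cumulative bound comes from a ghost sample. If a classifier has nonpositive empirical excess but
  large cumulative excess risk, its excess on the ghost sample is large with probability at least
  one half; exchanging data points and ghost points at random makes this difference a Rademacher sum over
  the at most \<open>\<Sum>i\<le>d. 2n choose i\<close> traces (Sauer--Shelah). The event on the
  double sample is measurable for the completed law, which suffices because the law is invariant
  under exchanges.
\<close>

subsection \<open>Growth function and Rademacher sums\<close>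

text \<open>The summed excess risk is the natural target because the pooled empirical risk minimiser
  competes with one classifier that is optimal for every law. All summands are therefore
  nonnegative, and a single event of probability \<open>1 - \<delta>\<close> yields every term of
  the minimum at once: no union bound over \<open>t\<close>, and no knowledge of the exponents.

  The bound is linear in the inverse sample size because for Bernstein exponent 1 the second moment
  of the loss relative to \<open>hs\<close> is at most \<open>C\<close> times its mean, under each
  law separately. Means and second moments both add up over independent points with different laws,
  so the argument runs on unnormalised sums, with Chernoff parameters of order
  \<open>1 / C\<close>.\<close>

definition trace_shattered :: "'a set set \<Rightarrow> 'a set \<Rightarrow> bool" where
  "trace_shattered F T \<longleftrightarrow> (\<lambda>A. A \<inter> T) ` F = Pow T"

text \<open>Pajor's form of Sauer--Shelah: counting shattered sets makes the induction additive.
  \<open>G\<close> holds the members avoiding \<open>a\<close>, \<open>G'\<close> those containing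
  \<open>a\<close> with \<open>a\<close> removed, and \<open>card G + card G'\<close> splits into
  union and intersection. Sets shattered by the union, and sets shattered by the intersection
  enlarged by \<open>a\<close>, are distinct and all shattered by \<open>F\<close>.\<close>

lemma pajor:
  assumes "finite S" "F \<subseteq> Pow S"
  shows "card F \<le> card {T. T \<subseteq> S \<and> trace_shattered F T}"
  using assms
proof (induction S arbitrary: F rule: finite_induct)
  case empty
  then have "F = {} \<or> F = {{}}" by auto
  then show ?case
  proof
    assume F: "F = {{}}"
    have "{T. T \<subseteq> {} \<and> trace_shattered F T} = {{}}"
      by (auto simp: trace_shattered_def F)
    then show ?case by (simp add: F)
  qed simp
next
  case (insert a S)
  define G where "G = {A \<in> F. a \<notin> A}"
  define G' where "G' = (\<lambda>A. A - {a}) ` {A \<in> F. a \<in> A}"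
  have finF: "finite F" using insert.prems insert.hyps by (meson finite.insertI finite_Pow_iff finite_subset)
  have "card F = card G + card {A \<in> F. a \<in> A}"
    unfolding G_def using finF
    by (subst card_Un_disjoint[symmetric]) (auto intro!: arg_cong[where f=card])
  also have "card {A \<in> F. a \<in> A} = card G'"
    unfolding G'_def by (rule card_image[symmetric]) (auto simp: inj_on_def)
  also have "card G + card G' = card (G \<union> G') + card (G \<inter> G')"
    by (rule card_Un_Int) (auto simp: G_def G'_def finF)
  finally have cF: "card F = card (G \<union> G') + card (G \<inter> G')" .
  have GS: "G \<union> G' \<subseteq> Pow S" "G \<inter> G' \<subseteq> Pow S"
    using insert.prems by (auto simp: G_def G'_def)
  let ?sh = "\<lambda>F S. {T. T \<subseteq> S \<and> trace_shattered F T}"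
  have 1: "?sh (G \<union> G') S \<subseteq> ?sh F (insert a S)"
  proof safe
    fix T assume T: "T \<subseteq> S" "trace_shattered (G \<union> G') T"
    have aT: "a \<notin> T" using T insert.hyps by auto
    have "(\<lambda>A. A \<inter> T) ` (G \<union> G') \<subseteq> (\<lambda>A. A \<inter> T) ` F"
      using aT by (force simp: G_def G'_def image_iff)
    then show "trace_shattered F T" using T(2) unfolding trace_shattered_def by auto
  qed auto
  \<comment> \<open>Each trace on \<open>T\<close> comes from some \<open>A\<close> such that both
    \<open>A\<close> and \<open>insert a A\<close> lie in \<open>F\<close>, so membership of
    \<open>a\<close> can be chosen freely.\<close>
  have 2: "insert a ` ?sh (G \<inter> G') S \<subseteq> ?sh F (insert a S)"
  proof safe
    fix T assume T: "T \<subseteq> S" "trace_shattered (G \<inter> G') T"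
    have aT: "a \<notin> T" using T insert.hyps by auto
    show "trace_shattered F (insert a T)"
      unfolding trace_shattered_def
    proof (intro equalityI subsetI)
      fix U assume U: "U \<in> Pow (insert a T)"
      then have "U - {a} \<in> (\<lambda>A. A \<inter> T) ` (G \<inter> G')"
        using T(2) unfolding trace_shattered_def by auto
      then obtain A where A: "A \<in> G" "A \<in> G'" "A \<inter> T = U - {a}" by auto
      have "A \<in> F" "a \<notin> A" using A(1) by (auto simp: G_def)
      have "insert a A \<in> F"
      proof -
        obtain B where B: "A = B - {a}" "B \<in> F" "a \<in> B" using A(2) unfolding G'_def by blast
        then have "insert a A = B" by blast
        then show ?thesis using B by simp
      qed
      show "U \<in> (\<lambda>A. A \<inter> insert a T) ` F"
      proof (cases "a \<in> U")
        case True
        then have "U = insert a A \<inter> insert a T" using A(3) by auto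
        then show ?thesis using \<open>insert a A \<in> F\<close> by (rule image_eqI)
      next
        case False
        then have "U = A \<inter> insert a T" using A(3) \<open>a \<notin> A\<close> by auto
        then show ?thesis using \<open>A \<in> F\<close> by (rule image_eqI)
      qed
    qed auto
  qed auto
  have inj: "inj_on (insert a) (?sh (G \<inter> G') S)"
    using insert.hyps(2) by (intro inj_onI) (metis (no_types, lifting) insert_ident mem_Collect_eq subsetD)
  have fin: "finite (?sh F (insert a S))"
    by (rule finite_subset[of _ "Pow (insert a S)"]) (use insert.hyps(1) in auto)
  have disj: "?sh (G \<union> G') S \<inter> insert a ` ?sh (G \<inter> G') S = {}"
    using insert.hyps(2) by blast
  have "card F \<le> card (?sh (G \<union> G') S) + card (?sh (G \<inter> G') S)"
    unfolding cF by (intro add_mono insert.IH GS)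
  also have "card (?sh (G \<inter> G') S) = card (insert a ` ?sh (G \<inter> G') S)"
    by (rule card_image[OF inj, symmetric])
  also have "card (?sh (G \<union> G') S) + \<dots> = card (?sh (G \<union> G') S \<union> insert a ` ?sh (G \<inter> G') S)"
    by (rule card_Un_disjoint[OF finite_subset[OF 1 fin] finite_subset[OF 2 fin] disj, symmetric])
  also have "\<dots> \<le> card (?sh F (insert a S))"
    by (rule card_mono[OF fin]) (use 1 2 in auto)
  finally show ?case .
qed

text \<open>Since \<open>x \<le> 1\<close>, multiplying by \<open>x ^ d\<close> costs no more than
  weighting the \<open>i\<close>-th term by \<open>x ^ i\<close>, which leaves a truncated binomial
  expansion.\<close>

lemma sum_binomial_le:
  fixes x :: real
  assumes "0 < x" "x \<le> 1"
  shows "(\<Sum>i\<le>d. real (m choose i)) \<le> inverse x ^ d * (1 + x) ^ m"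
proof -
  have "(\<Sum>i\<le>d. real (m choose i)) * x ^ d \<le> (\<Sum>i\<le>d. real (m choose i) * x ^ i)"
    unfolding sum_distrib_right
    by (intro sum_mono mult_left_mono power_decreasing) (use assms in auto)
  also have "\<dots> = (\<Sum>i\<in>{..d} \<inter> {..m}. real (m choose i) * x ^ i)"
    by (rule sum.mono_neutral_right) (auto simp: not_le)
  also have "\<dots> \<le> (\<Sum>i\<le>m. real (m choose i) * x ^ i)"
    by (rule sum_mono2) (use assms in auto)
  also have "\<dots> = (1 + x) ^ m"
    using binomial_ring[of x 1 m] by (simp add: add.commute)
  finally show ?thesis
    using assms by (simp add: field_simps)
qed

lemma growth_exp_bound:
  assumes "1 \<le> d" "1 \<le> n"
  shows "(\<Sum>i\<le>d. real ((2 * n) choose i)) \<le> exp (3 * real d * log1 (real n / real d))"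
proof -
  define L where "L = log1 (real n / real d)"
  have L1: "1 \<le> L" and Ln: "ln (real n / real d) \<le> L" by (auto simp: L_def log1_def)
  have "exp (ln (real n / real d)) \<le> exp L" using Ln by simp
  then have nd: "real n \<le> real d * exp L" using assms by (simp add: field_simps)
  \<comment> \<open>\<open>x = exp (-L)\<close> is at most \<open>min (d / n) 1\<close>, which covers \<open>n < d\<close> too\<close>
  have "(\<Sum>i\<le>d. real ((2 * n) choose i)) \<le> inverse (exp (-L)) ^ d * (1 + exp (-L)) ^ (2 * n)"
    using L1 by (intro sum_binomial_le) auto
  also have "inverse (exp (-L)) ^ d = exp (real d * L)"
    by (simp add: exp_minus exp_of_nat_mult)
  also have "(1 + exp (-L)) ^ (2 * n) \<le> exp (exp (-L)) ^ (2 * n)"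
    by (intro power_mono exp_ge_add_one_self) (auto intro: add_nonneg_nonneg)
  also have "\<dots> = exp (2 * (real n * exp (-L)))"
    by (simp add: exp_of_nat_mult[symmetric])
  also have "\<dots> \<le> exp (2 * real d)"
    using nd by (simp add: exp_minus field_simps)
  \<comment> \<open>The clamp in \<open>log1\<close> gives \<open>1 \<le> L\<close>, so
    \<open>2 d\<close> is absorbed into \<open>2 d L\<close>; hence the factor 3.\<close>
  also have "exp (real d * L) * exp (2 * real d) \<le> exp (3 * real d * L)"
    unfolding exp_add[symmetric] using L1 mult_left_mono[of 1 L "real d"] by (simp add: algebra_simps)
  finally show ?thesis by (simp add: L_def)
qed

section \<open>Exponential moments of random signs, and label patterns on finitely many
  points\<close>

lemma exp_le_quadratic:
  fixes x :: real
  assumes "\<bar>x\<bar> \<le> 1"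
  shows "exp x \<le> 1 + x + x\<^sup>2"
proof (cases "0 \<le> x")
  case True
  then show ?thesis using assms by (intro exp_bound) auto
next
  case False
  define y where "y = - x"
  have y: "0 \<le> y" using False by (simp add: y_def)
  \<comment> \<open>After multiplication by \<open>exp y\<close> the claim reads
    \<open>1 \<le> (1 - y + y^2) * exp y\<close>, and the quadratic Taylor polynomial of
    \<open>exp y\<close> already suffices.\<close>
  have "1 \<le> 1 + (y\<^sup>2 + y ^ 3 + y ^ 4) / 2" using y by simp
  also have "\<dots> = (1 - y + y\<^sup>2) * (1 + y + y\<^sup>2 / 2)"
    by (simp add: field_simps power2_eq_square power3_eq_cube power4_eq_xxxx)
  also have "\<dots> \<le> (1 - y + y\<^sup>2) * exp y"
  proof (rule mult_left_mono)
    show "1 + y + y\<^sup>2 / 2 \<le> exp y" using y by (rule exp_lower_Taylor_quadratic)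
    have "y \<le> 1" using assms by (simp add: y_def)
    then show "0 \<le> 1 - y + y\<^sup>2" by (simp add: add_nonneg_nonneg)
  qed
  finally have "exp (-y) \<le> 1 - y + y\<^sup>2" by (simp add: exp_minus field_simps)
  then show ?thesis by (simp add: y_def)
qed

definition swap_sign :: "bool \<Rightarrow> real" where
  "swap_sign b = (if b then - 1 else 1)"

text \<open>Chernoff's bound with counting in place of a probability on signs: the exponential sum
  over all sign vectors factorises, and in each factor the linear terms of
  \<open>exp_le_quadratic\<close> at plus and minus \<open>l * t i\<close> cancel.\<close>

lemma card_rademacher_ge:
  assumes fin: "finite I" and small: "\<And>i. i \<in> I \<Longrightarrow> \<bar>l * t i\<bar> \<le> 1" and l: "0 \<le> l"
  shows "real (card {e \<in> I \<rightarrow>\<^sub>E UNIV. a \<le> (\<Sum>i\<in>I. swap_sign (e i) * t i)})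
    \<le> 2 ^ card I * exp (l\<^sup>2 * (\<Sum>i\<in>I. (t i)\<^sup>2) - l * a)"
proof -
  let ?E = "I \<rightarrow>\<^sub>E (UNIV :: bool set)"
  let ?S = "\<lambda>e. \<Sum>i\<in>I. swap_sign (e i) * t i"
  have finE: "finite ?E" using fin by (intro finite_PiE) auto
  have "real (card {e \<in> ?E. a \<le> ?S e}) * exp (l * a) = (\<Sum>e\<in>{e \<in> ?E. a \<le> ?S e}. exp (l * a))"
    by simp
  also have "\<dots> \<le> (\<Sum>e\<in>{e \<in> ?E. a \<le> ?S e}. exp (l * ?S e))"
    by (intro sum_mono) (use l in \<open>auto intro: mult_left_mono\<close>)
  also have "\<dots> \<le> (\<Sum>e\<in>?E. exp (l * ?S e))"
    by (intro sum_mono2 finE) auto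
  also have "\<dots> = (\<Sum>e\<in>?E. \<Prod>i\<in>I. exp (l * (swap_sign (e i) * t i)))"
    using fin by (simp add: exp_sum sum_distrib_left)
  also have "\<dots> = (\<Prod>i\<in>I. \<Sum>b\<in>UNIV. exp (l * (swap_sign b * t i)))"
    using fin by (intro prod_sum_PiE[symmetric]) auto
  also have "\<dots> \<le> (\<Prod>i\<in>I. 2 * exp (l\<^sup>2 * (t i)\<^sup>2))"
  proof (intro prod_mono conjI)
    fix i assume i: "i \<in> I"
    have "(\<Sum>b\<in>UNIV. exp (l * (swap_sign b * t i))) = exp (l * t i) + exp (- (l * t i))"
      by (simp add: UNIV_bool swap_sign_def)
    also have "\<dots> \<le> (1 + l * t i + (l * t i)\<^sup>2) + (1 + - (l * t i) + (- (l * t i))\<^sup>2)"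
      by (intro add_mono exp_le_quadratic) (use small[OF i] in auto)
    also have "\<dots> = 2 * (1 + (l * t i)\<^sup>2)" by simp
    also have "\<dots> \<le> 2 * exp (l\<^sup>2 * (t i)\<^sup>2)"
      unfolding power_mult_distrib by (intro mult_left_mono exp_ge_add_one_self) simp
    finally show "(\<Sum>b\<in>UNIV. exp (l * (swap_sign b * t i))) \<le> 2 * exp (l\<^sup>2 * (t i)\<^sup>2)" .
  qed (auto intro: sum_nonneg)
  also have "\<dots> = 2 ^ card I * exp (l\<^sup>2 * (\<Sum>i\<in>I. (t i)\<^sup>2))"
    using fin by (simp add: prod.distrib exp_sum sum_distrib_left)
  finally show ?thesis
    by (simp add: exp_diff field_simps)
qed

lemma card_traces_le:
  assumes H: "H \<subseteq> space X \<rightarrow>\<^sub>E labels" and vc: "vc_dim X H = enat d"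
    and K: "finite K" and f: "f \<in> K \<rightarrow> space X"
  shows "finite ((\<lambda>h. \<lambda>k\<in>K. h (f k)) ` H)"
    and "card ((\<lambda>h. \<lambda>k\<in>K. h (f k)) ` H) \<le> (\<Sum>i\<le>d. card K choose i)"
proof -
  define S where "S = f ` K"
  define F where "F = (\<lambda>h. {x \<in> S. h x = 1}) ` H"
  have S: "finite S" "S \<subseteq> space X" using K f by (auto simp: S_def)
  have FS: "F \<subseteq> Pow S" by (auto simp: F_def)
  then have finF: "finite F" using S by (meson finite_Pow_iff finite_subset)
  have Tr: "(\<lambda>h. \<lambda>k\<in>K. h (f k)) ` H = (\<lambda>A. \<lambda>k\<in>K. if f k \<in> A then 1 else -1) ` F"
    unfolding F_def image_image
  proof (rule image_cong[OF refl])
    fix h assume "h \<in> H"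
    then have "h (f k) = 1 \<or> h (f k) = -1" if "k \<in> K" for k
      using H f that by fastforce
    then show "(\<lambda>k\<in>K. h (f k)) = (\<lambda>k\<in>K. if f k \<in> {x \<in> S. h x = 1} then 1 else -1)"
      by (auto simp: S_def fun_eq_iff restrict_def)
  qed
  then show "finite ((\<lambda>h. \<lambda>k\<in>K. h (f k)) ` H)" using finF by simp
  have shat: "shatters H T" if T: "T \<subseteq> S" "trace_shattered F T" for T
    unfolding shatters_def
  proof
    fix v assume v: "v \<in> T \<rightarrow> labels"
    have "{x \<in> T. v x = 1} \<in> (\<lambda>A. A \<inter> T) ` F"
      using T(2) unfolding trace_shattered_def by auto
    then obtain h where h: "h \<in> H" "{x \<in> S. h x = 1} \<inter> T = {x \<in> T. v x = 1}"
      by (auto simp: F_def)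
    have "h x = v x" if x: "x \<in> T" for x
    proof -
      have "h x \<in> labels" "v x \<in> labels" using h(1) H v x T(1) S(2) by blast+
      moreover have "h x = 1 \<longleftrightarrow> v x = 1" using h(2) x T(1) by auto
      ultimately show ?thesis by auto
    qed
    then show "\<exists>h\<in>H. \<forall>x\<in>T. h x = v x" using h(1) by blast
  qed
  have cardT: "card T \<le> d" if T: "T \<subseteq> S" "trace_shattered F T" for T
  proof -
    have "enat (card T) \<le> vc_dim X H"
      unfolding vc_dim_def using shat[OF T] T(1) S by (intro SUP_upper) (auto intro: finite_subset)
    then show ?thesis using vc by simp
  qed
  have "card ((\<lambda>h. \<lambda>k\<in>K. h (f k)) ` H) \<le> card F"
    unfolding Tr by (rule card_image_le[OF finF])
  also have "\<dots> \<le> card {T. T \<subseteq> S \<and> trace_shattered F T}"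
    by (rule pajor[OF S(1) FS])
  also have "\<dots> \<le> card (\<Union>i\<le>d. {T. T \<subseteq> S \<and> card T = i})"
    by (rule card_mono) (use S(1) cardT in auto)
  also have "\<dots> \<le> (\<Sum>i\<le>d. card {T. T \<subseteq> S \<and> card T = i})"
    by (rule card_UN_le) simp
  also have "\<dots> = (\<Sum>i\<le>d. card S choose i)"
    using S(1) by (intro sum.cong refl n_subsets) auto
  also have "\<dots> \<le> (\<Sum>i\<le>d. card K choose i)"
    by (intro sum_mono binomial_right_mono) (use K in \<open>auto simp: S_def intro: card_image_le\<close>)
  finally show "card ((\<lambda>h. \<lambda>k\<in>K. h (f k)) ` H) \<le> (\<Sum>i\<le>d. card K choose i)" .
qed

text \<open>Null sets of the image law pull back to null sets. This carries universal measurability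
  from tuples of instances to the labelled double sample.\<close>

lemma completion_vimage:
  assumes f: "f \<in> measurable M N" and T: "T \<in> sets (completion (distr M N f))"
  shows "f -` T \<inter> space M \<in> sets (completion M)"
proof -
  obtain S A A' where "T = S \<union> A" "A \<subseteq> A'" "A' \<in> null_sets (distr M N f)" "S \<in> sets (distr M N f)"
    using T by (rule sets_completionE)
  then show ?thesis using f
    by (intro sets_completionI[of _ "f -` S \<inter> space M" "f -` A \<inter> space M" "f -` A' \<inter> space M"])
      (auto simp: null_sets_distr_iff)
qed

subsection \<open>Ghost samples\<close>

text \<open>Double samples are indexed by \<open>I \<times> UNIV\<close>; the flag \<open>True\<close> marks the ghost points.\<close>

locale finite_sample =
  fixes I :: "'i set" and M :: "'i \<Rightarrow> 'z measure"
  assumes fin: "finite I" and prob: "\<And>i. prob_space (M i)"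
begin

sublocale product_prob_space M I
  by (intro product_prob_space.intro product_prob_space_axioms.intro product_sigma_finite.intro
    prob_space_imp_sigma_finite prob)

abbreviation idx :: "('i \<times> bool) set" where
  "idx \<equiv> I \<times> UNIV"

definition double_law :: "('i \<times> bool \<Rightarrow> 'z) measure" where
  "double_law = PiM idx (\<lambda>k. M (fst k))"

sublocale double_law: prob_space double_law
  unfolding double_law_def by (rule prob_space_PiM[OF prob])

definition join :: "('i \<Rightarrow> 'z) \<Rightarrow> ('i \<Rightarrow> 'z) \<Rightarrow> 'i \<times> bool \<Rightarrow> 'z" where
  "join a b = (\<lambda>k\<in>idx. if snd k then b (fst k) else a (fst k))"

text \<open>Inequality of booleans acts as exclusive or: point and ghost at \<open>i\<close> change
  places exactly if \<open>e i\<close>.\<close>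

definition swap :: "('i \<Rightarrow> bool) \<Rightarrow> ('i \<times> bool \<Rightarrow> 'z) \<Rightarrow> 'i \<times> bool \<Rightarrow> 'z" where
  "swap e z = (\<lambda>k\<in>idx. z (fst k, snd k \<noteq> e (fst k)))"

lemma finite_idx: "finite idx"
  using fin by simp

lemma measurable_join [measurable]:
  "(\<lambda>p. join (fst p) (snd p)) \<in> measurable (PiM I M \<Otimes>\<^sub>M PiM I M) double_law"
  unfolding join_def double_law_def
proof (rule measurable_restrict)
  fix k :: "'i \<times> bool" assume "k \<in> idx"
  then have k[measurable]: "fst k \<in> I" by auto
  show "(\<lambda>p. if snd k then snd p (fst k) else fst p (fst k))
      \<in> measurable (PiM I M \<Otimes>\<^sub>M PiM I M) (M (fst k))"
    by (cases "snd k") measurable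
qed

lemma distr_join: "distr (PiM I M \<Otimes>\<^sub>M PiM I M) double_law (\<lambda>p. join (fst p) (snd p)) = double_law"
proof -
  interpret D: product_sigma_finite "\<lambda>k :: 'i \<times> bool. M (fst k)"
    by (intro product_sigma_finite.intro prob_space_imp_sigma_finite prob)
  let ?D = "distr (PiM I M \<Otimes>\<^sub>M PiM I M) double_law (\<lambda>p. join (fst p) (snd p))"
  have "?D = PiM idx (\<lambda>k. M (fst k))"
  proof (rule D.PiM_eqI[OF finite_idx])
    show "sets ?D = sets (PiM idx (\<lambda>k. M (fst k)))" by (simp add: double_law_def)
    fix A assume A: "\<And>k. k \<in> idx \<Longrightarrow> A k \<in> sets (M (fst k))"
    have AD: "Pi\<^sub>E idx A \<in> sets double_law"
      unfolding double_law_def using A by (intro sets_PiM_I_finite finite_idx) auto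
    have AM: "Pi\<^sub>E I (\<lambda>i. A (i, s)) \<in> sets (PiM I M)" for s
      using A by (intro sets_PiM_I_finite fin) fastforce
    have sub: "A (i, s) \<subseteq> space (M i)" if "i \<in> I" for i s
      using A[of "(i, s)"] that by (auto dest: sets.sets_into_space)
    have pre: "(\<lambda>p. join (fst p) (snd p)) -` Pi\<^sub>E idx A \<inter> space (PiM I M \<Otimes>\<^sub>M PiM I M) =
        Pi\<^sub>E I (\<lambda>i. A (i, False)) \<times> Pi\<^sub>E I (\<lambda>i. A (i, True))" (is "?L = ?R")
    proof (rule set_eqI)
      fix p :: "('i \<Rightarrow> 'z) \<times> ('i \<Rightarrow> 'z)"
      obtain a b where p: "p = (a, b)" by (cases p)
      have "join a b \<in> Pi\<^sub>E idx A \<longleftrightarrow> (\<forall>i\<in>I. a i \<in> A (i, False) \<and> b i \<in> A (i, True))"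
        by (force simp: join_def PiE_iff)
      then show "p \<in> ?L \<longleftrightarrow> p \<in> ?R"
        unfolding p using sub by (auto simp: space_pair_measure space_PiM PiE_iff)
    qed
    have "emeasure ?D (Pi\<^sub>E idx A) =
        emeasure (PiM I M) (Pi\<^sub>E I (\<lambda>i. A (i, False))) * emeasure (PiM I M) (Pi\<^sub>E I (\<lambda>i. A (i, True)))"
      by (simp add: emeasure_distr AD pre P.emeasure_pair_measure_Times AM)
    also have "\<dots> = (\<Prod>i\<in>I. emeasure (M i) (A (i, False))) * (\<Prod>i\<in>I. emeasure (M i) (A (i, True)))"
      using A[of "(_, False)"] A[of "(_, True)"] by (simp add: emeasure_PiM[OF fin])
    also have "\<dots> = (\<Prod>i\<in>I. \<Prod>s\<in>UNIV. emeasure (M i) (A (i, s)))"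
      by (simp add: prod.distrib UNIV_bool mult.commute)
    also have "\<dots> = (\<Prod>k\<in>idx. emeasure (M (fst k)) (A k))"
      by (subst prod.Sigma) (auto simp: fin split_beta)
    finally show "emeasure ?D (Pi\<^sub>E idx A) = (\<Prod>k\<in>idx. emeasure (M (fst k)) (A k))" .
  qed
  then show ?thesis by (simp add: double_law_def)
qed

lemma measurable_swap [measurable]: "swap e \<in> measurable double_law double_law"
  unfolding swap_def double_law_def
proof (rule measurable_restrict)
  fix k :: "'i \<times> bool" assume "k \<in> idx"
  then have "(fst k, snd k \<noteq> e (fst k)) \<in> idx" by auto
  from measurable_component_singleton[OF this, of "\<lambda>k. M (fst k)"]
  show "(\<lambda>z. z (fst k, snd k \<noteq> e (fst k))) \<in> measurable (PiM idx (\<lambda>k. M (fst k))) (M (fst k))"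
    by simp
qed

text \<open>For fixed \<open>e\<close> the map only permutes coordinates carrying the same law,
  because the first index component is kept.\<close>

lemma distr_swap: "distr double_law double_law (swap e) = double_law"
proof -
  let ?f = "\<lambda>k. (fst k, snd k \<noteq> e (fst k))"
  have "inj_on ?f idx" by (auto simp: inj_on_def)
  then have "distr (PiM idx (\<lambda>k. M (fst k))) (\<Pi>\<^sub>M k\<in>idx. M (fst (?f k))) (\<lambda>z. \<lambda>k\<in>idx. z (?f k))
      = (\<Pi>\<^sub>M k\<in>idx. M (fst (?f k)))"
    by (intro distr_PiM_reindex prob) auto
  then show ?thesis by (simp add: double_law_def swap_def[abs_def])
qed

text \<open>\<open>A\<close> need not be measurable; it is covered by a superlevel set of the measure of the sections of \<open>J\<close>.\<close>

lemma ghost_sample: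
  assumes J: "J \<in> sets double_law"
    and A: "A \<subseteq> space (PiM I M)"
      "\<And>a. a \<in> A \<Longrightarrow> \<exists>B\<in>sets (PiM I M). measure (PiM I M) B \<ge> 1 / 2 \<and> (\<forall>b\<in>B. join a b \<in> J)"
  shows "\<exists>A'\<in>sets (PiM I M). A \<subseteq> A' \<and> measure (PiM I M) A' \<le> 2 * measure double_law J"
proof -
  let ?P = "PiM I M"
  let ?V = "(\<lambda>p. join (fst p) (snd p)) -` J \<inter> space (?P \<Otimes>\<^sub>M ?P)"
  define s where "s a = emeasure ?P (Pair a -` ?V)" for a
  have V: "?V \<in> sets (?P \<Otimes>\<^sub>M ?P)" by (rule measurable_sets[OF measurable_join J])
  have s[measurable]: "s \<in> borel_measurable ?P"
    unfolding s_def by (rule P.measurable_emeasure_Pair[OF V])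
  define A' where "A' = {a \<in> space ?P. 1 \<le> 2 * s a}"
  have A'[measurable]: "A' \<in> sets ?P" unfolding A'_def by measurable
  have "A \<subseteq> A'"
  proof
    fix a assume a: "a \<in> A"
    then obtain B where B: "B \<in> sets ?P" "measure ?P B \<ge> 1 / 2" "\<forall>b\<in>B. join a b \<in> J"
      using A(2) by blast
    have "B \<subseteq> Pair a -` ?V"
      using B a A(1) sets.sets_into_space[OF B(1)] by (auto simp: space_pair_measure)
    then have "emeasure ?P B \<le> s a"
      unfolding s_def by (intro emeasure_mono sets_Pair1[OF V])
    moreover have "ennreal (1 / 2) \<le> emeasure ?P B"
      unfolding P.emeasure_eq_measure by (rule ennreal_leI[OF B(2)])
    ultimately have "2 * ennreal (1 / 2) \<le> 2 * s a"
      by (intro mult_left_mono) auto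
    moreover have "2 * ennreal (1 / 2) = 1"
      using ennreal_mult[of 2 "1 / 2"] by simp
    ultimately show "a \<in> A'" using a A(1) by (auto simp: A'_def)
  qed
  moreover have "emeasure ?P A' \<le> 2 * (\<integral>\<^sup>+a. s a \<partial>?P)"
  proof -
    \<comment> \<open>Markov's inequality at level one half; this is the factor 2 in the failure
      probability.\<close>
    have "emeasure ?P A' \<le> 2 * (\<integral>\<^sup>+a. s a * indicator (space ?P) a \<partial>?P)"
      unfolding A'_def by (rule nn_integral_Markov_inequality) auto
    also have "(\<integral>\<^sup>+a. s a * indicator (space ?P) a \<partial>?P) = (\<integral>\<^sup>+a. s a \<partial>?P)"
      by (rule nn_integral_cong) simp
    finally show ?thesis .
  qed
  moreover have "(\<integral>\<^sup>+a. s a \<partial>?P) = emeasure double_law J"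
  proof -
    have "(\<integral>\<^sup>+a. s a \<partial>?P) = emeasure (?P \<Otimes>\<^sub>M ?P) ?V"
      unfolding s_def by (rule P.emeasure_pair_measure_alt[OF V, symmetric])
    also have "\<dots> = emeasure (distr (?P \<Otimes>\<^sub>M ?P) double_law (\<lambda>p. join (fst p) (snd p))) J"
      by (rule emeasure_distr[OF measurable_join J, symmetric])
    finally show ?thesis by (simp add: distr_join)
  qed
  ultimately have "ennreal (measure ?P A') \<le> ennreal (2 * measure double_law J)"
    by (simp add: P.emeasure_eq_measure double_law.emeasure_eq_measure ennreal_mult'' flip: ennreal_numeral)
  then show ?thesis using \<open>A \<subseteq> A'\<close> A' by (intro bexI[of _ A']) (auto simp: ennreal_le_iff)
qed

text \<open>Every exchange preserves \<open>double_law\<close>, so the measure of the event is the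
  mean, over \<open>z\<close>, of the proportion of exchanges that move \<open>z\<close> into it. A
  measurable cover is returned because \<open>ghost_sample\<close> integrates over sections.\<close>

lemma symmetrization:
  assumes J: "J \<in> sets (completion double_law)"
    and q: "\<And>z. z \<in> space double_law \<Longrightarrow> real (card {e \<in> I \<rightarrow>\<^sub>E UNIV. swap e z \<in> J}) \<le> 2 ^ card I * q"
  shows "\<exists>J'\<in>sets double_law. J \<subseteq> J' \<and> measure double_law J' \<le> q"
proof -
  let ?E = "I \<rightarrow>\<^sub>E (UNIV :: bool set)"
  have finE: "finite ?E" using fin by (intro finite_PiE) auto
  have cardE: "real (card ?E) = 2 ^ card I" using fin by (simp add: card_PiE)
  obtain S A N where JN: "J = S \<union> A" "A \<subseteq> N" "N \<in> null_sets double_law" "S \<in> sets double_law"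
    using J by (rule sets_completionE)
  define J' where "J' = S \<union> N"
  have J'[measurable]: "J' \<in> sets double_law" using JN by (auto simp: J'_def)
  have sw: "(\<integral>z. indicator J' (swap e z) \<partial>double_law) = measure double_law J'" for e
  proof -
    have "(\<integral>z. indicator J' (swap e z) \<partial>double_law) = (\<integral>z. indicator J' z \<partial>distr double_law double_law (swap e) :: real)"
      by (rule integral_distr[symmetric]) measurable
    then show ?thesis by (simp add: distr_swap)
  qed
  \<comment> \<open>The count \<open>q\<close> is assumed for \<open>J\<close>, but
    \<open>J'\<close> contains all of \<open>N\<close>. Finitely many law-preserving exchanges
    almost surely all miss \<open>N\<close>, and then both counts agree.\<close>
  have "AE z in double_law. swap e z \<notin> N" for e
  proof -
    have "AE z in distr double_law double_law (swap e). z \<notin> N"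
      unfolding distr_swap by (rule AE_not_in[OF JN(3)])
    then show ?thesis by (rule AE_distrD[OF measurable_swap])
  qed
  then have AE: "AE z in double_law. \<forall>e\<in>?E. swap e z \<notin> N"
    using finE by (intro AE_finite_allI) auto
  have int: "integrable double_law (\<lambda>z. indicator J' (swap e z) :: real)" for e
    by (rule double_law.integrable_const_bound[where B=1]) auto
  have "2 ^ card I * measure double_law J' = (\<Sum>e\<in>?E. \<integral>z. indicator J' (swap e z) \<partial>double_law)"
    by (simp add: sw cardE)
  also have "\<dots> = (\<integral>z. (\<Sum>e\<in>?E. indicator J' (swap e z)) \<partial>double_law)"
    by (rule Bochner_Integration.integral_sum[symmetric]) (rule int)
  also have "\<dots> \<le> (\<integral>z. 2 ^ card I * q \<partial>double_law)"
  proof (rule integral_mono_AE)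
    show "AE z in double_law. (\<Sum>e\<in>?E. indicator J' (swap e z)) \<le> 2 ^ card I * q"
      using AE AE_space
    proof eventually_elim
      case (elim z)
      have "(\<Sum>e\<in>?E. indicator J' (swap e z)) = (\<Sum>e\<in>?E. of_bool (swap e z \<in> J) :: real)"
        using elim JN by (intro sum.cong) (auto simp: J'_def indicator_def)
      also have "\<dots> = real (card {e \<in> ?E. swap e z \<in> J})"
        using finE by (simp add: sum.If_cases of_bool_def Int_def)
      also have "\<dots> \<le> 2 ^ card I * q" using elim q by auto
      finally show ?case .
    qed
  qed (auto intro: int)
  also have "\<dots> = 2 ^ card I * q" by (simp add: double_law.prob_space)
  finally have "measure double_law J' \<le> q" by simp
  then show ?thesis using JN by (intro bexI[OF _ J']) (auto simp: J'_def)
qed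

text \<open>Chernoff for independent summands with different laws: integrate
  \<open>exp_le_quadratic\<close> at \<open>- l * f i z\<close>, then use
  \<open>1 + u \<le> exp u\<close>. The range \<open>K\<close> enters only through the admissible
  \<open>l\<close>, so the exponent sees second moments.\<close>

lemma sum_lower_tail:
  assumes meas[measurable]: "\<And>i. i \<in> I \<Longrightarrow> f i \<in> borel_measurable (M i)"
    and bd: "\<And>i z. i \<in> I \<Longrightarrow> z \<in> space (M i) \<Longrightarrow> \<bar>f i z\<bar> \<le> K"
    and l: "0 \<le> l" "l * K \<le> 1"
  shows "measure (PiM I M) {b \<in> space (PiM I M). (\<Sum>i\<in>I. f i (b i)) \<le> a}
    \<le> exp (l * a - l * (\<Sum>i\<in>I. \<integral>z. f i z \<partial>M i) + l\<^sup>2 * (\<Sum>i\<in>I. \<integral>z. (f i z)\<^sup>2 \<partial>M i))"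
proof -
  let ?P = "PiM I M"
  let ?S = "\<lambda>b. \<Sum>i\<in>I. f i (b i)"
  let ?A = "{b \<in> space ?P. ?S b \<le> a}"
  have lf: "\<bar>- l * f i z\<bar> \<le> 1" if "i \<in> I" "z \<in> space (M i)" for i z
  proof -
    have "\<bar>- l * f i z\<bar> = l * \<bar>f i z\<bar>" using l by (simp add: abs_mult)
    also have "\<dots> \<le> l * K" using l bd[OF that] by (intro mult_left_mono)
    finally show ?thesis using l by simp
  qed
  have fint: "integrable (M i) (f i)" "integrable (M i) (\<lambda>z. (f i z)\<^sup>2)"
    "integrable (M i) (\<lambda>z. exp (- l * f i z))" if i: "i \<in> I" for i
  proof -
    note meas[OF i, measurable]
    show "integrable (M i) (f i)"
      using bd[OF i] by (intro M.integrable_const_bound[where B=K]) auto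
    have "(f i z)\<^sup>2 \<le> K\<^sup>2" if "z \<in> space (M i)" for z
      using power_mono[OF bd[OF i that], of 2] by simp
    then show "integrable (M i) (\<lambda>z. (f i z)\<^sup>2)"
      by (intro M.integrable_const_bound[where B="K\<^sup>2"]) auto
    have "exp (- l * f i z) \<le> exp 1" if "z \<in> space (M i)" for z
      using lf[OF i that] by (simp only: exp_le_cancel_iff)
    then show "integrable (M i) (\<lambda>z. exp (- l * f i z))"
      by (intro M.integrable_const_bound[where B="exp 1"]) auto
  qed
  have prodint: "integrable ?P (\<lambda>b. \<Prod>i\<in>I. exp (- l * f i (b i)))"
    by (rule product_integrable_prod[OF fin]) (rule fint)
  have expS: "exp (- l * ?S b) = (\<Prod>i\<in>I. exp (- l * f i (b i)))" for b
    using fin by (simp add: exp_sum[symmetric] sum_distrib_left sum_negf)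
  have [measurable]: "?S \<in> borel_measurable ?P" by measurable
  have A: "?A \<in> sets ?P" by measurable
  have "measure ?P ?A * exp (- l * a) = (\<integral>b. indicator ?A b * exp (- l * a) \<partial>?P)"
    using A by simp
  also have "\<dots> \<le> (\<integral>b. exp (- l * ?S b) \<partial>?P)"
  proof (rule integral_mono)
    show "integrable ?P (\<lambda>b. exp (- l * ?S b))" unfolding expS by (rule prodint)
    show "integrable ?P (\<lambda>b. indicator ?A b * exp (- l * a))"
      using A by (intro integrable_mult_left P.integrable_const_bound[where B=1]) auto
    show "indicator ?A b * exp (- l * a) \<le> exp (- l * ?S b)" for b
      using l by (auto simp: indicator_def intro: mult_left_mono)
  qed
  also have "\<dots> = (\<Prod>i\<in>I. \<integral>z. exp (- l * f i z) \<partial>M i)"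
    unfolding expS by (rule product_integral_prod[OF fin]) (rule fint)
  also have "\<dots> \<le> (\<Prod>i\<in>I. exp (- l * (\<integral>z. f i z \<partial>M i) + l\<^sup>2 * (\<integral>z. (f i z)\<^sup>2 \<partial>M i)))"
  proof (intro prod_mono conjI)
    fix i assume i: "i \<in> I"
    show "0 \<le> (\<integral>z. exp (- l * f i z) \<partial>M i)" by simp
    have "(\<integral>z. exp (- l * f i z) \<partial>M i) \<le> (\<integral>z. 1 + - l * f i z + l\<^sup>2 * (f i z)\<^sup>2 \<partial>M i)"
    proof (rule integral_mono)
      show "integrable (M i) (\<lambda>z. 1 + - l * f i z + l\<^sup>2 * (f i z)\<^sup>2)"
        by (intro Bochner_Integration.integrable_add integrable_mult_right fint[OF i]) simp
      show "exp (- l * f i z) \<le> 1 + - l * f i z + l\<^sup>2 * (f i z)\<^sup>2" if "z \<in> space (M i)" for z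
        using exp_le_quadratic[OF lf[OF i that]] by (simp add: power_mult_distrib)
    qed (rule fint[OF i])
    also have "\<dots> = 1 + (- l * (\<integral>z. f i z \<partial>M i) + l\<^sup>2 * (\<integral>z. (f i z)\<^sup>2 \<partial>M i))"
      using fint[OF i] by (simp add: M.prob_space)
    also have "\<dots> \<le> exp (- l * (\<integral>z. f i z \<partial>M i) + l\<^sup>2 * (\<integral>z. (f i z)\<^sup>2 \<partial>M i))"
      by (rule exp_ge_add_one_self)
    finally show "(\<integral>z. exp (- l * f i z) \<partial>M i) \<le> \<dots>" .
  qed
  also have "\<dots> = exp (- l * (\<Sum>i\<in>I. \<integral>z. f i z \<partial>M i) + l\<^sup>2 * (\<Sum>i\<in>I. \<integral>z. (f i z)\<^sup>2 \<partial>M i))"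
    using fin by (simp add: exp_sum[symmetric] sum_distrib_left sum_negf sum_subtractf)
  finally show ?thesis
    by (simp add: exp_add exp_diff exp_minus field_simps)
qed

end

subsection \<open>Uniform bound on the cumulative excess risk\<close>

text \<open>Extensional classifiers that differ must differ at a point of the instance space, and
  that single point is shattered.\<close>

lemma vc_dim_pos:
  assumes H: "H \<subseteq> space X \<rightarrow>\<^sub>E labels" and fg: "f \<in> H" "g \<in> H" "f \<noteq> g" and vc: "vc_dim X H = enat d"
  shows "1 \<le> d"
proof -
  obtain x where x: "x \<in> space X" "f x \<noteq> g x"
    using fg H by (meson PiE_ext subsetD)
  have fgx: "f x \<in> labels" "g x \<in> labels" using fg(1,2) H x(1) by blast+
  have "shatters H {x}"
    unfolding shatters_def
  proof
    fix v :: "'a \<Rightarrow> int" assume "v \<in> {x} \<rightarrow> labels"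
    then have "v x = f x \<or> v x = g x" using fgx x(2) by auto
    then show "\<exists>h\<in>H. \<forall>y\<in>{x}. h y = v y" using fg(1,2) by auto
  qed
  then have "enat (card {x}) \<le> vc_dim X H"
    unfolding vc_dim_def using x(1) by (intro SUP_upper) auto
  then show ?thesis using vc by (simp add: one_enat_def)
qed

lemma neq_measurable:
  assumes "f \<in> measurable N (count_space labels)" "g \<in> measurable N (count_space labels)"
  shows "{z \<in> space N. f z \<noteq> g z} \<in> sets N"
proof -
  have "{z \<in> space N. f z \<noteq> g z} =
      (f -` {1} \<inter> space N \<inter> (g -` {-1} \<inter> space N)) \<union> (f -` {-1} \<inter> space N \<inter> (g -` {1} \<inter> space N))"
    using measurable_space[OF assms(1)] measurable_space[OF assms(2)] by fastforce
  also have "\<dots> \<in> sets N"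
    by (intro sets.Un sets.Int measurable_sets[OF assms(1)] measurable_sets[OF assms(2)]) auto
  finally show ?thesis .
qed

lemma integral_of_bool:
  "(\<integral>z. of_bool (P z) \<partial>N) = measure N {z \<in> space N. P z}"
proof -
  have "(\<integral>z. of_bool (P z) \<partial>N) = (\<integral>z. indicator {z \<in> space N. P z} z \<partial>N :: real)"
    by (rule Bochner_Integration.integral_cong) (auto simp: indicator_def)
  also have "\<dots> = measure N ({z \<in> space N. P z} \<inter> space N)" by simp
  also have "{z \<in> space N. P z} \<inter> space N = {z \<in> space N. P z}" by blast
  finally show ?thesis .
qed

lemma of_bool_measurable:
  assumes "{z \<in> space N. P z} \<in> sets N"
  shows "(\<lambda>z. of_bool (P z) :: real) \<in> borel_measurable N"
proof -
  have "(indicator {z \<in> space N. P z} :: _ \<Rightarrow> real) \<in> borel_measurable N" using assms by simp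
  then show ?thesis by (rule measurable_cong[THEN iffD1, rotated]) (auto simp: indicator_def)
qed

locale erm_sample = finite_sample I M
  for I :: "'i set" and M :: "'i \<Rightarrow> ('x \<times> int) measure" +
  fixes X :: "'x measure" and H :: "('x \<Rightarrow> int) set" and d :: nat and hs :: "'x \<Rightarrow> int" and C :: real
  assumes sets_M: "\<And>i. sets (M i) = sets (labelled X)"
    and cls: "classifier_class X H" and vc: "vc_dim X H = enat d"
    and hs: "hs \<in> H" and C: "2 \<le> C" and I_ne: "I \<noteq> {}"
    and bern: "\<And>i h. h \<in> H \<Longrightarrow> disagreement X (M i) h hs \<le> C * (risk (M i) h - risk (M i) hs)"
begin

text \<open>The argument is a predicted label, not a classifier, so that the quantities below are
  functions of a label pattern on the double sample, of which there are finitely many.\<close>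

definition excess_loss :: "int \<Rightarrow> 'x \<times> int \<Rightarrow> real" where
  "excess_loss v z = of_bool (v \<noteq> snd z) - of_bool (hs (fst z) \<noteq> snd z)"

text \<open>
  The weight \<open>kappa\<close> penalises disagreement with \<open>hs\<close>. On the swap-invariant side of
  \<open>exceeds\<close> below, the same penalty bounds the variance of the random signs, so that no separate
  uniform control of the empirical disagreement is needed.
\<close>

definition kappa :: real where
  "kappa = 1 / (3 * C)"

definition penalised_loss :: "int \<Rightarrow> 'x \<times> int \<Rightarrow> real" where
  "penalised_loss v z = excess_loss v z - kappa * \<bar>excess_loss v z\<bar>"

definition gap :: "('i \<times> bool \<Rightarrow> int) \<Rightarrow> ('i \<times> bool \<Rightarrow> 'x \<times> int) \<Rightarrow> 'i \<Rightarrow> real" where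
  "gap v w i = penalised_loss (v (i, True)) (w (i, True)) - penalised_loss (v (i, False)) (w (i, False))"

definition mass :: "('i \<times> bool \<Rightarrow> int) \<Rightarrow> ('i \<times> bool \<Rightarrow> 'x \<times> int) \<Rightarrow> 'i \<Rightarrow> real" where
  "mass v w i = \<bar>excess_loss (v (i, True)) (w (i, True))\<bar> + \<bar>excess_loss (v (i, False)) (w (i, False))\<bar>"

definition exceeds :: "real \<Rightarrow> ('i \<times> bool \<Rightarrow> int) \<Rightarrow> ('i \<times> bool \<Rightarrow> 'x \<times> int) \<Rightarrow> bool" where
  "exceeds B v w \<longleftrightarrow>
     B / 4 + kappa / 2 * (\<Sum>i\<in>I. mass v w i) \<le> (\<Sum>i\<in>I. gap v w i)"

text \<open>
  This event must not mention the risks: it has to depend on \<open>h\<close> only through its trace on the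
  double sample, since nothing else about \<open>H\<close> is known to be measurable.
\<close>

definition double_bad :: "real \<Rightarrow> ('i \<times> bool \<Rightarrow> 'x \<times> int) set" where
  "double_bad B = {w \<in> space double_law. \<exists>h\<in>H. exceeds B (\<lambda>k. h (fst (w k))) w}"

lemma H_ext: "H \<subseteq> space X \<rightarrow>\<^sub>E labels"
  and H_measurable: "h \<in> H \<Longrightarrow> h \<in> measurable X (count_space labels)"
  and H_traces: "universally_measurable_traces X H"
  using cls by (auto simp: classifier_class_def)

lemma d_pos: "1 \<le> d"
proof -
  obtain F where F: "F \<subseteq> H" "card F = 3" using cls by (auto simp: classifier_class_def)
  then obtain f g where "f \<in> F" "g \<in> F" "f \<noteq> g"
    by (metis card_3_iff insertI1 insertI2)
  then show ?thesis using F(1) H_ext vc by (intro vc_dim_pos[of H X f g]) auto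
qed

lemma kappa_pos: "0 < kappa" and kappa_le: "kappa \<le> 1 / 6" and kappa_C: "kappa * C = 1 / 3"
  using C by (auto simp: kappa_def field_simps)

lemma abs_excess_loss_le: "\<bar>excess_loss v z\<bar> \<le> 1"
  by (auto simp: excess_loss_def)

text \<open>The values are -1, 0 and 1, so a bound on the mean absolute loss is a bound on the
  second moment.\<close>

lemma excess_loss_sq: "(excess_loss v z)\<^sup>2 = \<bar>excess_loss v z\<bar>"
  by (auto simp: excess_loss_def)

lemma space_M: "space (M i) = space X \<times> labels"
  using sets_eq_imp_space_eq[OF sets_M[of i]] by (simp add: space_pair_measure)

lemma measurable_M: "measurable (M i) N = measurable (labelled X) N"
  by (rule measurable_cong_sets[OF sets_M refl])

lemma fst_measurable [measurable]: "fst \<in> measurable (M i) X"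
  unfolding measurable_M by measurable

lemma snd_measurable [measurable]: "snd \<in> measurable (M i) (count_space labels)"
  unfolding measurable_M by measurable

lemma h_measurable [measurable]: "h \<in> H \<Longrightarrow> (\<lambda>z. h (fst z)) \<in> measurable (M i) (count_space labels)"
  by (rule measurable_compose[OF fst_measurable H_measurable])

lemma excess_loss_measurable [measurable]:
  assumes "f \<in> measurable (M i) (count_space labels)"
  shows "(\<lambda>z. excess_loss (f z) z) \<in> borel_measurable (M i)"
  unfolding excess_loss_def
  by (intro borel_measurable_diff of_bool_measurable neq_measurable snd_measurable h_measurable hs assms)

lemma integrable_excess_loss: "h \<in> H \<Longrightarrow> integrable (M i) (\<lambda>z. excess_loss (h (fst z)) z)"
  using abs_excess_loss_le by (intro M.integrable_const_bound[where B=1]) auto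

lemma integral_excess_loss:
  assumes "h \<in> H"
  shows "(\<integral>z. excess_loss (h (fst z)) z \<partial>M i) = risk (M i) h - risk (M i) hs"
proof -
  have int: "integrable (M i) (\<lambda>z. of_bool (g (fst z) \<noteq> snd z) :: real)" if "g \<in> H" for g
    by (intro M.integrable_const_bound[where B=1] of_bool_measurable neq_measurable h_measurable that)
      (auto simp: snd_measurable)
  show ?thesis
    unfolding excess_loss_def risk_def
    by (subst Bochner_Integration.integral_diff[OF int[OF assms] int[OF hs]])
      (simp add: integral_of_bool)
qed

text \<open>The relative loss vanishes where \<open>h\<close> and \<open>hs\<close> agree, so its
  mean absolute value is at most the disagreement. This is the point where the Bernstein condition
  enters.\<close>

lemma integral_abs_excess_loss:
  assumes h: "h \<in> H"
  shows "(\<integral>z. \<bar>excess_loss (h (fst z)) z\<bar> \<partial>M i) \<le> C * (risk (M i) h - risk (M i) hs)"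
proof -
  have ms: "{z \<in> space (M i). h (fst z) \<noteq> hs (fst z)} \<in> sets (M i)"
    by (intro neq_measurable h_measurable h hs)
  have "{x \<in> space X. h x \<noteq> hs x} \<in> sets X"
    by (intro neq_measurable H_measurable h hs)
  then have "disagreement X (M i) h hs = measure (M i) (fst -` {x \<in> space X. h x \<noteq> hs x} \<inter> space (M i))"
    unfolding disagreement_def by (intro measure_distr fst_measurable)
  also have "fst -` {x \<in> space X. h x \<noteq> hs x} \<inter> space (M i) = {z \<in> space (M i). h (fst z) \<noteq> hs (fst z)}"
    by (auto simp: space_M)
  finally have dis: "disagreement X (M i) h hs = (\<integral>z. of_bool (h (fst z) \<noteq> hs (fst z)) \<partial>M i)"
    by (simp add: integral_of_bool)
  have "(\<integral>z. \<bar>excess_loss (h (fst z)) z\<bar> \<partial>M i) \<le> (\<integral>z. of_bool (h (fst z) \<noteq> hs (fst z)) \<partial>M i)"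
    by (intro integral_mono integrable_abs integrable_excess_loss h M.integrable_const_bound[where B=1]
        of_bool_measurable ms) (auto simp: excess_loss_def)
  then show ?thesis using bern[OF h, of i] dis by linarith
qed

section \<open>Measurability of the event on the double sample\<close>

lemma dup_component:
  assumes "k \<in> idx"
  shows "(\<lambda>w. w k) \<in> measurable double_law (M (fst k))"
  unfolding double_law_def by (rule measurable_component_singleton[OF assms])

lemma space_dupD: "w \<in> space double_law \<Longrightarrow> k \<in> idx \<Longrightarrow> w k \<in> space X \<times> labels"
  by (auto simp: double_law_def space_PiM PiE_iff space_M)

text \<open>A union over all of \<open>H\<close> may be uncountable. Regrouped by label patterns
  \<open>v\<close>, it becomes a finite union of intersections: \<open>v\<close> is realised on the
  instances, which is universally measurable, and \<open>exceeds B v\<close> holds, which is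
  measurable outright. The enumeration \<open>e\<close> turns \<open>idx\<close> into the initial
  segment used by \<open>universally_measurable_traces\<close>.\<close>

lemma double_bad_completion: "double_bad B \<in> sets (completion double_law)"
proof -
  define m where "m = card idx"
  obtain e where e: "bij_betw e {..<m} idx"
    unfolding m_def using ex_bij_betw_nat_finite[OF finite_idx] by (auto simp: atLeast0LessThan)
  then have e_in: "e j \<in> idx" if "j < m" for j using that by (auto simp: bij_betw_def)
  define G where "G w = (\<lambda>j\<in>{..<m}. fst (w (e j)))" for w :: "'i \<times> bool \<Rightarrow> 'x \<times> int"
  let ?XM = "\<Pi>\<^sub>M j\<in>{..<m}. X"
  define T where "T v = {x \<in> space ?XM. \<exists>h\<in>H. \<forall>j<m. h (x j) = v (e j)}" for v :: "'i \<times> bool \<Rightarrow> int"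
  have G: "G \<in> measurable double_law ?XM"
    unfolding G_def
  proof (rule measurable_restrict)
    fix j assume "j \<in> {..<m}"
    then have "e j \<in> idx" by (auto intro: e_in)
    from dup_component[OF this] show "(\<lambda>w. fst (w (e j))) \<in> measurable double_law X"
      by (rule measurable_compose) (rule fst_measurable)
  qed
  have "T v \<in> sets (completion (distr double_law ?XM G))" if v: "v \<in> idx \<rightarrow>\<^sub>E labels" for v
  proof -
    have vL: "(\<lambda>j. v (e j)) \<in> {..<m} \<rightarrow> labels"
    proof
      fix j assume "j \<in> {..<m}"
      then show "v (e j) \<in> labels" using PiE_mem[OF v e_in] by simp
    qed
    \<comment> \<open>The joint law of the instances in the double sample is the \<open>Q\<close> at
      which the universal measurability is applied.\<close>
    have "prob_space (distr double_law ?XM G)" by (rule double_law.prob_space_distr[OF G])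
    with H_traces vL show ?thesis
      unfolding universally_measurable_traces_def T_def by simp
  qed
  then have TG: "G -` T v \<inter> space double_law \<in> sets (completion double_law)" if "v \<in> idx \<rightarrow>\<^sub>E labels" for v
    using that by (intro completion_vimage[OF G])
  have ex: "{w \<in> space double_law. exceeds B v w} \<in> sets (completion double_law)" if v: "v \<in> idx \<rightarrow>\<^sub>E labels" for v
  proof -
    have [measurable]: "(\<lambda>w. excess_loss (v (i, s)) (w (i, s))) \<in> borel_measurable double_law" if "i \<in> I" for i s
    proof -
      have k: "(i, s) \<in> idx" using that by simp
      have "v (i, s) \<in> labels" using PiE_mem[OF v k] .
      then have "(\<lambda>z. excess_loss (v (i, s)) z) \<in> borel_measurable (M i)"
        by (intro excess_loss_measurable measurable_const) simp
      then show ?thesis using measurable_compose[OF dup_component[OF k]] by simp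
    qed
    have "{w \<in> space double_law. exceeds B v w} \<in> sets double_law"
      unfolding exceeds_def gap_def mass_def penalised_loss_def by measurable
    then show ?thesis by simp
  qed
  have "double_bad B = (\<Union>v\<in>idx \<rightarrow>\<^sub>E labels. (G -` T v \<inter> space double_law) \<inter> {w \<in> space double_law. exceeds B v w})"
    (is "_ = ?R")
  proof (intro equalityI subsetI)
    fix w assume "w \<in> double_bad B"
    then obtain h where w: "w \<in> space double_law" and h: "h \<in> H" and exh: "exceeds B (\<lambda>k. h (fst (w k))) w"
      by (auto simp: double_bad_def)
    define v where "v = (\<lambda>k\<in>idx. h (fst (w k)))"
    have "h (fst (w k)) \<in> labels" if "k \<in> idx" for k
      using space_dupD[OF w that] h H_ext by (force simp: mem_Times_iff)
    then have v: "v \<in> idx \<rightarrow>\<^sub>E labels" by (auto simp: v_def simp del: insert_iff)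
    have "exceeds B v w" using exh by (simp add: exceeds_def gap_def mass_def v_def)
    moreover have "G w \<in> T v"
      unfolding T_def
    proof (intro CollectI conjI bexI[OF _ h] allI impI)
      show "G w \<in> space ?XM" by (rule measurable_space[OF G w])
      show "h (G w j) = v (e j)" if "j < m" for j using that e_in[OF that] by (simp add: G_def v_def)
    qed
    ultimately show "w \<in> ?R" using v w by blast
  next
    fix w assume "w \<in> ?R"
    then obtain v where w: "w \<in> space double_law" "G w \<in> T v" "exceeds B v w" by blast
    then obtain h where h: "h \<in> H" "\<And>j. j < m \<Longrightarrow> h (G w j) = v (e j)" by (auto simp: T_def)
    have "h (fst (w k)) = v k" if "k \<in> idx" for k
    proof -
      have "k \<in> e ` {..<m}" using e that unfolding bij_betw_def by blast
      then obtain j where "j < m" "k = e j" by blast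
      then show ?thesis using h(2)[of j] by (simp add: G_def)
    qed
    then have "exceeds B (\<lambda>k. h (fst (w k))) w \<longleftrightarrow> exceeds B v w" by (simp add: exceeds_def gap_def mass_def)
    then show "w \<in> double_bad B" using w h(1) by (auto simp: double_bad_def)
  qed
  also have "\<dots> \<in> sets (completion double_law)"
    by (intro sets.finite_UN sets.Int TG ex) (auto intro!: finite_PiE finite_idx)
  finally show ?thesis .
qed

section \<open>Random exchanges on a fixed double sample\<close>

lemma swap_apply: "i \<in> I \<Longrightarrow> swap e w (i, b) = w (i, b \<noteq> e i)"
  by (simp add: swap_def)

lemma join_apply: "i \<in> I \<Longrightarrow> join a b (i, s) = (if s then b i else a i)"
  by (simp add: join_def)

text \<open>An exchange at \<open>i\<close> negates \<open>gap\<close> and leaves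
  \<open>mass\<close> unchanged. For a fixed double sample this is a Rademacher sum against a
  threshold independent of the signs.\<close>

lemma exceeds_swap:
  "exceeds B (\<lambda>k. h (fst (swap e w k))) (swap e w) \<longleftrightarrow>
     B / 4 + kappa / 2 * (\<Sum>i\<in>I. mass (\<lambda>k. h (fst (w k))) w i)
       \<le> (\<Sum>i\<in>I. swap_sign (e i) * gap (\<lambda>k. h (fst (w k))) w i)"
proof -
  have "(\<Sum>i\<in>I. mass (\<lambda>k. h (fst (swap e w k))) (swap e w) i) = (\<Sum>i\<in>I. mass (\<lambda>k. h (fst (w k))) w i)"
    by (intro sum.cong refl) (simp add: mass_def swap_apply split: bool.split, smt (verit))
  moreover have "(\<Sum>i\<in>I. gap (\<lambda>k. h (fst (swap e w k))) (swap e w) i)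
      = (\<Sum>i\<in>I. swap_sign (e i) * gap (\<lambda>k. h (fst (w k))) w i)"
    by (intro sum.cong) (auto simp: gap_def swap_apply swap_sign_def)
  ultimately show ?thesis by (simp add: exceeds_def)
qed

lemma abs_penalised_loss_le: "\<bar>penalised_loss v z\<bar> \<le> 7 / 6 * \<bar>excess_loss v z\<bar>"
proof -
  have "\<bar>penalised_loss v z\<bar> \<le> \<bar>excess_loss v z\<bar> + kappa * \<bar>excess_loss v z\<bar>"
    unfolding penalised_loss_def using kappa_pos by (intro order.trans[OF abs_triangle_ineq4]) (simp add: abs_mult)
  also have "kappa * \<bar>excess_loss v z\<bar> \<le> 1 / 6 * \<bar>excess_loss v z\<bar>"
    using kappa_le by (intro mult_right_mono) auto
  finally show ?thesis by simp
qed

lemma abs_gap_le: "\<bar>gap v w i\<bar> \<le> 7 / 6 * mass v w i"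
  unfolding gap_def mass_def
  using abs_penalised_loss_le[of "v (i, True)" "w (i, True)"] abs_penalised_loss_le[of "v (i, False)" "w (i, False)"]
  by (intro order.trans[OF abs_triangle_ineq4]) (simp add: distrib_left)

lemma mass_bounds: "0 \<le> mass v w i" "mass v w i \<le> 2"
  unfolding mass_def
  using abs_excess_loss_le[of "v (i, True)" "w (i, True)"] abs_excess_loss_le[of "v (i, False)" "w (i, False)"]
  by linarith+

text \<open>Replacing one factor \<open>mass\<close> by its bound 2 makes the variance proxy linear
  in \<open>mass\<close>, the form in which the threshold of \<open>exceeds\<close> can absorb
  it.\<close>

lemma gap_sq_le: "(gap v w i)\<^sup>2 \<le> 4 * mass v w i"
proof -
  have "(gap v w i)\<^sup>2 \<le> (7 / 6 * mass v w i)\<^sup>2"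
    using power_mono[OF abs_gap_le[of v w i] abs_ge_zero, of 2] by simp
  also have "\<dots> = 49 / 36 * (mass v w i * mass v w i)" by (simp add: power2_eq_square)
  also have "\<dots> \<le> 49 / 36 * (2 * mass v w i)"
    using mass_bounds[of v w i] by (intro mult_left_mono mult_right_mono) auto
  finally show ?thesis using mass_bounds[of v w i] by linarith
qed

text \<open>The parameter \<open>kappa / 8\<close> makes the variance term
  \<open>kappa^2 / 16\<close> times the total mass cancel exactly against the mass in the threshold,
  leaving only \<open>B\<close>.\<close>

lemma card_signs_le:
  "real (card {e \<in> I \<rightarrow>\<^sub>E UNIV. B / 4 + kappa / 2 * (\<Sum>i\<in>I. mass v w i) \<le> (\<Sum>i\<in>I. swap_sign (e i) * gap v w i)})
    \<le> 2 ^ card I * exp (- (kappa * B / 32))"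
proof -
  let ?U = "\<Sum>i\<in>I. mass v w i"
  have "real (card {e \<in> I \<rightarrow>\<^sub>E UNIV. B / 4 + kappa / 2 * ?U \<le> (\<Sum>i\<in>I. swap_sign (e i) * gap v w i)})
    \<le> 2 ^ card I * exp ((kappa / 8)\<^sup>2 * (\<Sum>i\<in>I. (gap v w i)\<^sup>2) - kappa / 8 * (B / 4 + kappa / 2 * ?U))"
  proof (rule card_rademacher_ge[OF fin])
    fix i
    have "\<bar>gap v w i\<bar> \<le> 7 / 3" using abs_gap_le[of v w i] mass_bounds[of v w i] by linarith
    then have "(kappa / 8) * \<bar>gap v w i\<bar> \<le> (1 / 48) * (7 / 3)"
      using kappa_pos kappa_le by (intro mult_mono) auto
    then show "\<bar>kappa / 8 * gap v w i\<bar> \<le> 1" using kappa_pos by (simp add: abs_mult)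
  qed (use kappa_pos in simp)
  also have "(kappa / 8)\<^sup>2 * (\<Sum>i\<in>I. (gap v w i)\<^sup>2) \<le> (kappa / 8)\<^sup>2 * (4 * ?U)"
    unfolding sum_distrib_left[of 4] by (intro mult_left_mono sum_mono gap_sq_le) auto
  then have "(kappa / 8)\<^sup>2 * (\<Sum>i\<in>I. (gap v w i)\<^sup>2) - kappa / 8 * (B / 4 + kappa / 2 * ?U)
      \<le> - (kappa * B / 32)"
    by (simp add: field_simps power2_eq_square)
  then have "2 ^ card I * exp ((kappa / 8)\<^sup>2 * (\<Sum>i\<in>I. (gap v w i)\<^sup>2) - kappa / 8 * (B / 4 + kappa / 2 * ?U))
      \<le> 2 ^ card I * exp (- (kappa * B / 32))"
    by simp
  finally show ?thesis .
qed

text \<open>Exchanges do not change which instances occur, so the label patterns on \<open>w\<close>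
  itself serve for all \<open>e\<close>, and a union bound over them suffices.\<close>

lemma card_swap_bad:
  assumes w: "w \<in> space double_law"
  shows "real (card {e \<in> I \<rightarrow>\<^sub>E UNIV. swap e w \<in> double_bad B})
    \<le> 2 ^ card I * (exp (3 * real d * log1 (real (card I) / real d)) * exp (- (kappa * B / 32)))"
proof -
  define Tr where "Tr = (\<lambda>h. \<lambda>k\<in>idx. h (fst (w k))) ` H"
  define Ev where "Ev v = {e \<in> I \<rightarrow>\<^sub>E UNIV. B / 4 + kappa / 2 * (\<Sum>i\<in>I. mass v w i) \<le>
      (\<Sum>i\<in>I. swap_sign (e i) * gap v w i)}" for v
  have w_in: "(\<lambda>k. fst (w k)) \<in> idx \<rightarrow> space X"
    using space_dupD[OF w] by (auto simp: mem_Times_iff)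
  have finTr: "finite Tr" and "card Tr \<le> (\<Sum>i\<le>d. card idx choose i)"
    unfolding Tr_def using card_traces_le[OF H_ext vc finite_idx w_in] by auto
  then have "real (card Tr) \<le> real (\<Sum>i\<le>d. card idx choose i)" by linarith
  also have "\<dots> = (\<Sum>i\<le>d. real ((2 * card I) choose i))"
    by (simp add: card_cartesian_product mult.commute)
  also have "\<dots> \<le> exp (3 * real d * log1 (real (card I) / real d))"
    using I_ne fin by (intro growth_exp_bound d_pos) (simp add: Suc_leI card_gt_0_iff)
  finally have cTr: "real (card Tr) \<le> exp (3 * real d * log1 (real (card I) / real d))" .
  have "{e \<in> I \<rightarrow>\<^sub>E UNIV. swap e w \<in> double_bad B} \<subseteq> (\<Union>v\<in>Tr. Ev v)"
  proof
    fix e assume e: "e \<in> {e \<in> I \<rightarrow>\<^sub>E UNIV. swap e w \<in> double_bad B}"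
    then obtain h where h: "h \<in> H" "exceeds B (\<lambda>k. h (fst (swap e w k))) (swap e w)"
      by (auto simp: double_bad_def)
    let ?v = "\<lambda>k\<in>idx. h (fst (w k))"
    have "(\<Sum>i\<in>I. mass ?v w i) = (\<Sum>i\<in>I. mass (\<lambda>k. h (fst (w k))) w i)"
      "(\<Sum>i\<in>I. swap_sign (e i) * gap ?v w i) = (\<Sum>i\<in>I. swap_sign (e i) * gap (\<lambda>k. h (fst (w k))) w i)"
      by (auto intro!: sum.cong simp: mass_def gap_def)
    then have "e \<in> Ev ?v" using h(2) e unfolding exceeds_swap Ev_def by auto
    then show "e \<in> (\<Union>v\<in>Tr. Ev v)" using h(1) by (auto simp: Tr_def)
  qed
  moreover have "finite (\<Union>v\<in>Tr. Ev v)"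
    using fin finTr by (auto simp: Ev_def intro!: finite_subset[OF _ finite_PiE[of I "\<lambda>_. UNIV :: bool set"]])
  ultimately have "card {e \<in> I \<rightarrow>\<^sub>E UNIV. swap e w \<in> double_bad B} \<le> card (\<Union>v\<in>Tr. Ev v)"
    by (rule card_mono[rotated])
  also have "\<dots> \<le> (\<Sum>v\<in>Tr. card (Ev v))" by (rule card_UN_le[OF finTr])
  finally have "real (card {e \<in> I \<rightarrow>\<^sub>E UNIV. swap e w \<in> double_bad B}) \<le> (\<Sum>v\<in>Tr. real (card (Ev v)))"
    by (simp flip: of_nat_sum)
  also have "\<dots> \<le> (\<Sum>v\<in>Tr. 2 ^ card I * exp (- (kappa * B / 32)))"
    unfolding Ev_def by (intro sum_mono card_signs_le)
  also have "\<dots> = 2 ^ card I * (real (card Tr) * exp (- (kappa * B / 32)))" by simp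
  also have "\<dots> \<le> 2 ^ card I * (exp (3 * real d * log1 (real (card I) / real d)) * exp (- (kappa * B / 32)))"
    by (intro mult_left_mono mult_right_mono cTr) auto
  finally show ?thesis .
qed

text \<open>
  Chernoff with exponent \<open>1 / (16 C)\<close>: by the Bernstein condition the penalty
  \<open>3/2 kappa\<close> costs only half of the mean, and the second moments sum to at most
  \<open>2 C\<close> times the cumulative excess risk.
\<close>

lemma ghost_lower:
  assumes h: "h \<in> H" and mu: "B \<le> (\<Sum>i\<in>I. risk (M i) h - risk (M i) hs)" and B: "128 * C \<le> B"
  defines "E \<equiv> {b \<in> space (PiM I M). B / 4 \<le>
    (\<Sum>i\<in>I. excess_loss (h (fst (b i))) (b i) - 3 / 2 * kappa * \<bar>excess_loss (h (fst (b i))) (b i)\<bar>)}"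
  shows "E \<in> sets (PiM I M)" "1 / 2 \<le> measure (PiM I M) E"
proof -
  let ?f = "\<lambda>z. excess_loss (h (fst z)) z - 3 / 2 * kappa * \<bar>excess_loss (h (fst z)) z\<bar>"
  let ?F = "{b \<in> space (PiM I M). (\<Sum>i\<in>I. ?f (b i)) \<le> B / 4}"
  let ?mu = "\<Sum>i\<in>I. risk (M i) h - risk (M i) hs"
  have f[measurable]: "?f \<in> borel_measurable (M i)" for i
    by (intro borel_measurable_diff borel_measurable_times borel_measurable_const borel_measurable_abs
        excess_loss_measurable h_measurable h)
  have S[measurable]: "(\<lambda>b. \<Sum>i\<in>I. ?f (b i)) \<in> borel_measurable (PiM I M)"
  proof (rule borel_measurable_sum)
    fix i assume "i \<in> I"
    from measurable_component_singleton[OF this]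
    show "(\<lambda>b. ?f (b i)) \<in> borel_measurable (PiM I M)"
      by (rule measurable_compose[OF _ f])
  qed
  show E: "E \<in> sets (PiM I M)" unfolding E_def using S by measurable
  have F: "?F \<in> sets (PiM I M)" using S by measurable
  define l where "l = 1 / (16 * C)"
  have l: "0 \<le> l" "l * 2 \<le> 1" using C by (auto simp: l_def field_simps)
  have s: "0 \<le> 3 / 2 * kappa" "3 / 2 * kappa \<le> 1 / 4" "3 / 2 * kappa * C = 1 / 2"
    using kappa_pos kappa_le kappa_C by (auto simp: field_simps)
  have f_le: "\<bar>?f z\<bar> \<le> 5 / 4 * \<bar>excess_loss (h (fst z)) z\<bar>" for z
  proof -
    have "\<bar>?f z\<bar> \<le> \<bar>excess_loss (h (fst z)) z\<bar> + 3 / 2 * kappa * \<bar>excess_loss (h (fst z)) z\<bar>"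
      using s(1) by (intro order.trans[OF abs_triangle_ineq4]) (simp add: abs_mult)
    also have "3 / 2 * kappa * \<bar>excess_loss (h (fst z)) z\<bar> \<le> 1 / 4 * \<bar>excess_loss (h (fst z)) z\<bar>"
      by (intro mult_right_mono s) auto
    finally show ?thesis by simp
  qed
  have f2: "\<bar>?f z\<bar> \<le> 2" for z
    using f_le[of z] abs_excess_loss_le[of "h (fst z)" z] by linarith
  have fsq: "(?f z)\<^sup>2 \<le> 2 * \<bar>excess_loss (h (fst z)) z\<bar>" for z
  proof -
    have "(?f z)\<^sup>2 \<le> (5 / 4 * \<bar>excess_loss (h (fst z)) z\<bar>)\<^sup>2"
      using power_mono[OF f_le[of z] abs_ge_zero, of 2] by simp
    also have "\<dots> = 25 / 16 * \<bar>excess_loss (h (fst z)) z\<bar>"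
      by (simp add: power_mult_distrib excess_loss_sq power_divide)
    finally show ?thesis using abs_ge_zero[of "excess_loss (h (fst z)) z"] by linarith
  qed
  have Ef: "(risk (M i) h - risk (M i) hs) / 2 \<le> (\<integral>z. ?f z \<partial>M i)" for i
  proof -
    have "(\<integral>z. ?f z \<partial>M i) = (risk (M i) h - risk (M i) hs) - 3 / 2 * kappa * (\<integral>z. \<bar>excess_loss (h (fst z)) z\<bar> \<partial>M i)"
      using integrable_excess_loss[OF h, of i]
      by (subst Bochner_Integration.integral_diff) (auto simp: integral_excess_loss[OF h])
    moreover have "3 / 2 * kappa * (\<integral>z. \<bar>excess_loss (h (fst z)) z\<bar> \<partial>M i) \<le> (risk (M i) h - risk (M i) hs) / 2"
    proof -
      have "3 / 2 * kappa * (\<integral>z. \<bar>excess_loss (h (fst z)) z\<bar> \<partial>M i)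
          \<le> 3 / 2 * kappa * (C * (risk (M i) h - risk (M i) hs))"
        by (intro mult_left_mono integral_abs_excess_loss h s)
      also have "\<dots> = (3 / 2 * kappa * C) * (risk (M i) h - risk (M i) hs)" by (rule mult.assoc[symmetric])
      finally show ?thesis unfolding s(3) by simp
    qed
    ultimately show ?thesis by argo
  qed
  have Ef2: "(\<integral>z. (?f z)\<^sup>2 \<partial>M i) \<le> 2 * (C * (risk (M i) h - risk (M i) hs))" for i
  proof -
    have f24: "(?f z)\<^sup>2 \<le> 4" for z using power_mono[OF f2[of z] abs_ge_zero, of 2] by simp
    have "(\<integral>z. (?f z)\<^sup>2 \<partial>M i) \<le> (\<integral>z. 2 * \<bar>excess_loss (h (fst z)) z\<bar> \<partial>M i)"
    proof (rule integral_mono)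
      show "integrable (M i) (\<lambda>z. (?f z)\<^sup>2)"
        by (rule M.integrable_const_bound[where B=4]) (use f24 f in \<open>auto intro!: borel_measurable_power\<close>)
      show "integrable (M i) (\<lambda>z. 2 * \<bar>excess_loss (h (fst z)) z\<bar>)"
        by (intro integrable_mult_right integrable_abs integrable_excess_loss h)
    qed (rule fsq)
    also have "\<dots> = 2 * (\<integral>z. \<bar>excess_loss (h (fst z)) z\<bar> \<partial>M i)" by simp
    finally show ?thesis using integral_abs_excess_loss[OF h, of i] by linarith
  qed
  have "measure (PiM I M) ?F
      \<le> exp (l * (B / 4) - l * (\<Sum>i\<in>I. \<integral>z. ?f z \<partial>M i) + l\<^sup>2 * (\<Sum>i\<in>I. \<integral>z. (?f z)\<^sup>2 \<partial>M i))"
    by (rule sum_lower_tail[OF f f2 l])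
  also have "\<dots> \<le> exp (-1)"
  proof -
    have 1: "?mu / 2 \<le> (\<Sum>i\<in>I. \<integral>z. ?f z \<partial>M i)"
      unfolding sum_divide_distrib by (intro sum_mono Ef)
    have 2: "(\<Sum>i\<in>I. \<integral>z. (?f z)\<^sup>2 \<partial>M i) \<le> 2 * (C * ?mu)"
      unfolding sum_distrib_left by (intro sum_mono Ef2)
    have "l * (B / 4) - l * (\<Sum>i\<in>I. \<integral>z. ?f z \<partial>M i) + l\<^sup>2 * (\<Sum>i\<in>I. \<integral>z. (?f z)\<^sup>2 \<partial>M i)
        \<le> l * (?mu / 4) - l * (?mu / 2) + l\<^sup>2 * (2 * (C * ?mu))"
      using l mu by (intro add_mono diff_mono mult_left_mono 1 2) auto
    \<comment> \<open>The first two terms give \<open>- ?mu / (64 * C)\<close>, and the second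
      moment returns half of that. The requirement \<open>128 * C \<le> B\<close> is what makes the
      exponent at most -1.\<close>
    also have "\<dots> = - (?mu / (128 * C))"
      using C by (simp add: l_def field_simps power2_eq_square)
    also have "\<dots> \<le> -1" using C B mu by (simp add: field_simps)
    finally show ?thesis by simp
  qed
  also have "exp (-1) \<le> (1 / 2 :: real)"
    using exp_ge_add_one_self[of 1] by (simp add: exp_minus field_simps)
  finally have "measure (PiM I M) ?F \<le> 1 / 2" .
  moreover have "measure (PiM I M) (space (PiM I M) - ?F) \<le> measure (PiM I M) E"
    by (rule P.finite_measure_mono[OF _ E]) (auto simp: E_def)
  ultimately show "1 / 2 \<le> measure (PiM I M) E"
    using P.prob_compl[OF F] by linarith
qed

lemma cumulative_excess_bound:
  assumes B: "128 * C \<le> B"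
  shows "\<exists>A\<in>sets (PiM I M).
    1 - 2 * (exp (3 * real d * log1 (real (card I) / real d)) * exp (- (kappa * B / 32))) \<le> measure (PiM I M) A \<and>
    (\<forall>z\<in>A. \<forall>h\<in>H. (\<Sum>i\<in>I. excess_loss (h (fst (z i))) (z i)) \<le> 0 \<longrightarrow>
       (\<Sum>i\<in>I. risk (M i) h - risk (M i) hs) \<le> B)"
proof -
  let ?P = "PiM I M"
  let ?q = "exp (3 * real d * log1 (real (card I) / real d)) * exp (- (kappa * B / 32))"
  obtain J where J: "J \<in> sets double_law" "double_bad B \<subseteq> J" "measure double_law J \<le> ?q"
    using symmetrization[OF double_bad_completion card_swap_bad] by blast
  \<comment> \<open>The risks select the bad samples here, and \<open>ghost_lower\<close> turns them
    into a deviation of the ghost sample. The event \<open>double_bad B\<close> then retains only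
    label patterns.\<close>
  define A0 where "A0 = {a \<in> space ?P. \<exists>h\<in>H. (\<Sum>i\<in>I. excess_loss (h (fst (a i))) (a i)) \<le> 0 \<and>
      B < (\<Sum>i\<in>I. risk (M i) h - risk (M i) hs)}"
  have "\<exists>A'\<in>sets ?P. A0 \<subseteq> A' \<and> measure ?P A' \<le> 2 * measure double_law J"
  proof (rule ghost_sample[OF J(1)])
    show "A0 \<subseteq> space ?P" by (auto simp: A0_def)
    fix a assume "a \<in> A0"
    then obtain h where a: "a \<in> space ?P" and h: "h \<in> H" and le: "(\<Sum>i\<in>I. excess_loss (h (fst (a i))) (a i)) \<le> 0"
      and mu: "B \<le> (\<Sum>i\<in>I. risk (M i) h - risk (M i) hs)"
      by (auto simp: A0_def)
    note E = ghost_lower[OF h mu B]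
    show "\<exists>B\<in>sets ?P. 1 / 2 \<le> measure ?P B \<and> (\<forall>b\<in>B. join a b \<in> J)"
    proof (intro bexI[OF _ E(1)] conjI ballI E(2))
      fix b assume "b \<in> {b \<in> space ?P. B / 4 \<le>
        (\<Sum>i\<in>I. excess_loss (h (fst (b i))) (b i) - 3 / 2 * kappa * \<bar>excess_loss (h (fst (b i))) (b i)\<bar>)}"
      then have b: "b \<in> space ?P" and "B / 4 \<le>
        (\<Sum>i\<in>I. excess_loss (h (fst (b i))) (b i) - 3 / 2 * kappa * \<bar>excess_loss (h (fst (b i))) (b i)\<bar>)" by auto
      then have bB: "B / 4 \<le> (\<Sum>i\<in>I. excess_loss (h (fst (b i))) (b i)) - 3 / 2 * kappa * (\<Sum>i\<in>I. \<bar>excess_loss (h (fst (b i))) (b i)\<bar>)"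
        by (simp add: sum_subtractf sum_distrib_left)
      have 0: "0 \<le> kappa * (\<Sum>i\<in>I. \<bar>excess_loss (h (fst (a i))) (a i)\<bar>)"
        using kappa_pos by (intro mult_nonneg_nonneg sum_nonneg) auto
      \<comment> \<open>Of the ghost penalty \<open>3/2 kappa\<close>, one \<open>kappa\<close> is
        the penalty inside \<open>gap\<close> and the other half pays for the ghost part of
        \<open>mass\<close>. On the data side the loss sum is nonpositive, so the penalty
        contributes \<open>kappa\<close> times the absolute losses, twice what \<open>mass\<close>
        requires.\<close>
      have "exceeds B (\<lambda>k. h (fst (join a b k))) (join a b) \<longleftrightarrow>
          B / 4 + kappa / 2 * ((\<Sum>i\<in>I. \<bar>excess_loss (h (fst (b i))) (b i)\<bar>) + (\<Sum>i\<in>I. \<bar>excess_loss (h (fst (a i))) (a i)\<bar>))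
          \<le> ((\<Sum>i\<in>I. excess_loss (h (fst (b i))) (b i)) - kappa * (\<Sum>i\<in>I. \<bar>excess_loss (h (fst (b i))) (b i)\<bar>))
            - ((\<Sum>i\<in>I. excess_loss (h (fst (a i))) (a i)) - kappa * (\<Sum>i\<in>I. \<bar>excess_loss (h (fst (a i))) (a i)\<bar>))"
        unfolding exceeds_def gap_def mass_def penalised_loss_def
        by (simp add: join_apply sum_subtractf sum.distrib sum_distrib_left cong: sum.cong)
      then have "exceeds B (\<lambda>k. h (fst (join a b k))) (join a b)"
        using bB 0 le by (simp add: algebra_simps)
      moreover have "join a b \<in> space double_law"
        using measurable_space[OF measurable_join, of "(a, b)"] a b by (simp add: space_pair_measure)
      ultimately show "join a b \<in> J" using h J(2) by (auto simp: double_bad_def)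
    qed
  qed
  then obtain A' where A': "A' \<in> sets ?P" "A0 \<subseteq> A'" "measure ?P A' \<le> 2 * measure double_law J" by blast
  show ?thesis
  proof (intro bexI[of _ "space ?P - A'"] conjI ballI impI)
    show "1 - 2 * ?q \<le> measure ?P (space ?P - A')"
      using P.prob_compl[OF A'(1)] A'(3) J(3) by linarith
    fix z h assume "z \<in> space ?P - A'" "h \<in> H" "(\<Sum>i\<in>I. excess_loss (h (fst (z i))) (z i)) \<le> 0"
    then show "(\<Sum>i\<in>I. risk (M i) h - risk (M i) hs) \<le> B"
      using A'(2) by (force simp: A0_def)
  qed (use A'(1) in auto)
qed

lemma erm_cumulative_bound:
  assumes \<delta>: "0 < \<delta>" "\<delta> < 1"
  shows "\<exists>A\<in>sets (PiM I M). 1 - \<delta> \<le> measure (PiM I M) A \<and>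
    (\<forall>z\<in>A. \<forall>h\<in>H. empirical_risk I z h \<le> empirical_risk I z hs \<longrightarrow>
       (\<Sum>i\<in>I. risk (M i) h - risk (M i) hs)
         \<le> 400 * C * (real d * log1 (real (card I) / real d) + log1 (1 / \<delta>)))"
proof -
  let ?L = "log1 (real (card I) / real d)" and ?D = "log1 (1 / \<delta>)"
  define B where "B = 400 * C * (real d * ?L + ?D)"
  have L: "1 \<le> ?L" "1 \<le> ?D" "ln (1 / \<delta>) \<le> ?D" by (auto simp: log1_def)
  have dL: "1 \<le> real d * ?L" using d_pos L(1) mult_mono[of 1 "real d" 1 ?L] by simp
  have "400 * C * 1 \<le> B" unfolding B_def using C L(2) dL by (intro mult_left_mono) auto
  then have B: "128 * C \<le> B" using C by linarith
  have "kappa * B = kappa * C * 400 * (real d * ?L + ?D)" by (simp add: B_def)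
  \<comment> \<open>The constant 400 gives the coefficient 400 / 96, which exceeds 4: 3 pays for the
    label patterns, and the surplus of more than 1 on \<open>d * ?L\<close> pays for the factor 2.
    The share of \<open>?D\<close> covers \<open>ln (1 / \<delta>)\<close>.\<close>
  then have kB: "kappa * B / 32 = 400 / 96 * (real d * ?L + ?D)" unfolding kappa_C by linarith
  have "2 * (exp (3 * real d * ?L) * exp (- (kappa * B / 32))) = 2 * exp (3 * (real d * ?L) - 400 / 96 * (real d * ?L + ?D))"
    by (simp only: kB exp_add[symmetric]) (simp add: algebra_simps)
  \<comment> \<open>The factor 2 of the ghost sample is absorbed as
    \<open>2 \<le> exp 1\<close>.\<close>
  also have "\<dots> \<le> exp 1 * exp (-1 - ln (1 / \<delta>))"
  proof (rule mult_mono)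
    have "3 * (real d * ?L) - 400 / 96 * (real d * ?L + ?D) \<le> -1 - ln (1 / \<delta>)"
      using dL L(2,3) unfolding distrib_left by linarith
    then show "exp (3 * (real d * ?L) - 400 / 96 * (real d * ?L + ?D)) \<le> exp (-1 - ln (1 / \<delta>))"
      by simp
  qed (use exp_ge_add_one_self[of 1] in auto)
  also have "\<dots> = \<delta>" using \<delta> by (simp add: exp_add[symmetric] ln_div)
  finally have q: "2 * (exp (3 * real d * ?L) * exp (- (kappa * B / 32))) \<le> \<delta>" .
  obtain A where A: "A \<in> sets (PiM I M)" "1 - \<delta> \<le> measure (PiM I M) A"
    and bd: "\<And>z h. z \<in> A \<Longrightarrow> h \<in> H \<Longrightarrow> (\<Sum>i\<in>I. excess_loss (h (fst (z i))) (z i)) \<le> 0 \<Longrightarrow>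
       (\<Sum>i\<in>I. risk (M i) h - risk (M i) hs) \<le> B"
    using cumulative_excess_bound[OF B] q by (smt (verit, best))
  show ?thesis
    unfolding B_def[symmetric]
  proof (intro bexI[OF _ A(1)] conjI A(2) ballI impI)
    fix z h assume z: "z \<in> A" and h: "h \<in> H" and le: "empirical_risk I z h \<le> empirical_risk I z hs"
    have "0 < real (card I)" using I_ne fin by (simp add: card_gt_0_iff)
    then have "real (card {i \<in> I. h (fst (z i)) \<noteq> snd (z i)}) \<le> real (card {i \<in> I. hs (fst (z i)) \<noteq> snd (z i)})"
      using le by (simp add: empirical_risk_def divide_le_cancel)
    then have "(\<Sum>i\<in>I. excess_loss (h (fst (z i))) (z i)) \<le> 0"
      using fin by (simp add: excess_loss_def sum_subtractf of_bool_def sum.If_cases Int_def)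
    then show "(\<Sum>i\<in>I. risk (M i) h - risk (M i) hs) \<le> B" by (rule bd[OF z h])
  qed
qed

end

subsection \<open>From cumulative excess risk to the target\<close>

text \<open>Jensen's inequality for \<open>exp\<close> at the points \<open>r s * ln x\<close>;
  positivity of \<open>x\<close> makes \<open>powr\<close> an exponential.\<close>

lemma powr_convex_combination:
  fixes x :: real
  assumes "finite S" "0 < x" "\<And>s. s \<in> S \<Longrightarrow> 0 \<le> a s" "sum a S = 1"
  shows "x powr (\<Sum>s\<in>S. a s * r s) \<le> (\<Sum>s\<in>S. a s * x powr r s)"
proof -
  have "S \<noteq> {}" using assms(4) by auto
  then have "exp (\<Sum>s\<in>S. a s *\<^sub>R (r s * ln x)) \<le> (\<Sum>s\<in>S. a s * exp (r s * ln x))"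
    using assms by (intro convex_on_sum[OF _ _ exp_convex]) auto
  then show ?thesis
    using assms(2) by (simp add: powr_def sum_distrib_right mult.assoc)
qed

text \<open>
  With \<open>x = E (N + 1) / C\<rho>\<close> the transfer exponents give \<open>x powr \<rho> s \<le> E s\<close>, and convexity
  of \<open>r \<mapsto> x powr r\<close> moves the average over the \<open>t\<close> best samples into the exponent.
\<close>

lemma rate_bound:
  fixes E :: "nat \<Rightarrow> real" and n :: "nat \<Rightarrow> nat" and \<rho> :: "nat \<Rightarrow> ereal"
  assumes E: "\<And>s. s \<in> {1..N+1} \<Longrightarrow> 0 \<le> E s" "E (N + 1) \<le> 1"
    and C\<rho>: "2 \<le> C\<rho>" and \<rho>: "\<rho> (N + 1) = 1"
    and src: "\<And>s. s \<in> {1..N} \<Longrightarrow> 1 \<le> n s" "\<And>s. s \<in> {1..N} \<Longrightarrow> 0 < \<rho> s"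
    and tr: "\<And>s. s \<in> {1..N} \<Longrightarrow> E (N + 1) \<le> C\<rho> * rpow (E s) (real_of_ereal (1 / \<rho> s))"
    and total: "(\<Sum>s\<in>{1..N+1}. real (n s) * E s) \<le>
      c * C\<beta> * (real d * log1 (1 / real d * real (\<Sum>s\<in>{1..N+1}. n s)) + log1 (1 / \<delta>))"
    and \<sigma>: "bij_betw \<sigma> {1..N+1} {1..N+1}" and t: "t \<in> {1..N+1}"
  shows "ereal (E (N + 1)) \<le> rate c d \<delta> N C\<rho> \<rho> n C\<beta> \<sigma> t"
proof (cases "(\<Sum>s\<in>{1..t}. n (\<sigma> s)) = 0")
  case True
  then show ?thesis unfolding rate_def by simp
next
  case False
  define T where "T = real (\<Sum>s\<in>{1..t}. n (\<sigma> s))"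
  define B where "B = c * C\<beta> * (real d * log1 (1 / real d * real (\<Sum>s\<in>{1..N+1}. n s)) + log1 (1 / \<delta>))"
  define \<alpha> where "\<alpha> s = real (n (\<sigma> s)) / T" for s
  have T: "0 < T" using False unfolding T_def of_nat_0_less_iff by blast
  have \<alpha>_nonneg: "0 \<le> \<alpha> s" for s using T by (simp add: \<alpha>_def)
  have \<sigma>_in: "\<sigma> s \<in> {1..N+1}" if "s \<in> {1..t}" for s
    using \<sigma> that t by (auto simp: bij_betw_def)
  have rate: "rate c d \<delta> N C\<rho> \<rho> n C\<beta> \<sigma> t =
      ereal (C\<rho> * rpow (B / T) (real_of_ereal (1 / avg_exponent \<rho> n \<sigma> t)))"
    using False unfolding rate_def B_def T_def by (simp add: mult.assoc)
  have avg: "avg_exponent \<rho> n \<sigma> t = (\<Sum>s\<in>{1..t}. ereal (\<alpha> s) * \<rho> (\<sigma> s))"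
    unfolding avg_exponent_def \<alpha>_def T_def ..
  have \<rho>_pos: "0 < \<rho> (\<sigma> s)" if "s \<in> {1..t}" for s
    using \<sigma>_in[OF that] src(2) \<rho> by (cases "\<sigma> s = N + 1") auto
  show ?thesis
  proof (cases "\<exists>s\<in>{1..t}. \<rho> (\<sigma> s) = \<infinity>")
    case True
    then obtain s where s: "s \<in> {1..t}" "\<rho> (\<sigma> s) = \<infinity>" by blast
    \<comment> \<open>An infinite exponent belongs to a source, which has at least one data point.
      Its weight is positive, the average is infinite, and the rate becomes \<open>C\<rho>\<close>,
      which is at least 1. A zero weight would give \<open>0 * \<infinity> = 0\<close>
      instead.\<close>
    then have "\<sigma> s \<noteq> N + 1" using \<rho> by auto
    then have "1 \<le> n (\<sigma> s)" using \<sigma>_in[OF s(1)] by (intro src(1)) auto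
    then have "0 < \<alpha> s" using T by (simp add: \<alpha>_def)
    then have inf: "ereal (\<alpha> s) * \<rho> (\<sigma> s) = \<infinity>" using s(2) by simp
    have "0 \<le> ereal (\<alpha> s) * \<rho> (\<sigma> s)" if "s \<in> {1..t}" for s
      using \<rho>_pos[OF that] \<alpha>_nonneg[of s] by (intro ereal_0_le_mult) auto
    then have "ereal (\<alpha> s) * \<rho> (\<sigma> s) \<le> avg_exponent \<rho> n \<sigma> t"
      unfolding avg using s(1) sum_mono2[of "{1..t}" "{s}" "\<lambda>s. ereal (\<alpha> s) * \<rho> (\<sigma> s)"] by simp
    then have "avg_exponent \<rho> n \<sigma> t = \<infinity>" unfolding inf by (simp only: ereal_infty_less_eq(1))
    then show ?thesis unfolding rate using E(2) C\<rho> by (simp add: rpow_def)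
  next
    case False
    define r where "r s = real_of_ereal (\<rho> (\<sigma> s))" for s
    have r: "\<rho> (\<sigma> s) = ereal (r s)" "0 < r s" if "s \<in> {1..t}" for s
      using False \<rho>_pos[OF that] that by (cases "\<rho> (\<sigma> s)"; auto simp: r_def)+
    define a where "a = (\<Sum>s\<in>{1..t}. \<alpha> s * r s)"
    have avg_a: "avg_exponent \<rho> n \<sigma> t = ereal a"
      unfolding avg a_def using r(1) by (simp flip: sum_ereal)
    have sum_\<alpha>: "sum \<alpha> {1..t} = 1"
      using T by (simp add: \<alpha>_def T_def flip: sum_divide_distrib)
    \<comment> \<open>The target may contribute no data, so positivity of the average needs an index
      with positive weight.\<close>
    obtain s0 where s0: "s0 \<in> {1..t}" "n (\<sigma> s0) \<noteq> 0"
      using \<open>(\<Sum>s\<in>{1..t}. n (\<sigma> s)) \<noteq> 0\<close> by (meson sum.neutral)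
    have "0 < a"
      unfolding a_def
    proof (rule sum_pos2[OF _ s0(1)])
      show "0 < \<alpha> s0 * r s0" using s0 r(2) T by (simp add: \<alpha>_def)
      show "0 \<le> \<alpha> s * r s" if "s \<in> {1..t}" for s using r(2)[OF that] \<alpha>_nonneg[of s] by simp
    qed simp
    then have rate_a: "rate c d \<delta> N C\<rho> \<rho> n C\<beta> \<sigma> t = ereal (C\<rho> * (B / T) powr (1 / a))"
      unfolding rate avg_a by (simp add: rpow_def one_ereal_def)
    show ?thesis
    proof (cases "E (N + 1) = 0")
      case True
      then show ?thesis unfolding rate_a using C\<rho> by simp
    next
      case False
      define x where "x = E (N + 1) / C\<rho>"
      have "0 < E (N + 1)" using E(1)[of "N + 1"] False by simp
      then have x: "0 < x" "x \<le> E (N + 1)" using C\<rho> by (auto simp: x_def field_simps)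
      have xr: "x powr r s \<le> E (\<sigma> s)" if s: "s \<in> {1..t}" for s
      proof (cases "\<sigma> s = N + 1")
        case True
        then have "r s = 1" using \<rho> by (simp add: r_def)
        then show ?thesis using x True by simp
      next
        case False
        then have "\<sigma> s \<in> {1..N}" using \<sigma>_in[OF s] by auto
        from tr[OF this] have "E (N + 1) \<le> C\<rho> * E (\<sigma> s) powr (1 / r s)"
          using r[OF s] by (simp add: rpow_def one_ereal_def)
        then have "x \<le> E (\<sigma> s) powr (1 / r s)" using C\<rho> by (simp add: x_def field_simps)
        then have "x powr r s \<le> (E (\<sigma> s) powr (1 / r s)) powr r s"
          using x r(2)[OF s] by (intro powr_mono2) auto
        then show ?thesis using r(2)[OF s] E(1)[OF \<sigma>_in[OF s]] by (simp add: powr_powr)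
      qed
      have "x powr a \<le> (\<Sum>s\<in>{1..t}. \<alpha> s * x powr r s)"
        unfolding a_def using x(1) \<alpha>_nonneg sum_\<alpha> by (intro powr_convex_combination) auto
      also have "\<dots> \<le> (\<Sum>s\<in>{1..t}. \<alpha> s * E (\<sigma> s))"
        by (intro sum_mono mult_left_mono xr \<alpha>_nonneg)
      also have "\<dots> = (\<Sum>s\<in>{1..t}. real (n (\<sigma> s)) * E (\<sigma> s)) / T"
        by (simp add: \<alpha>_def sum_divide_distrib)
      \<comment> \<open>Nonnegative excess risks allow the partial sum to be completed to the total
        over all samples, where the order is irrelevant.\<close>
      also have "(\<Sum>s\<in>{1..t}. real (n (\<sigma> s)) * E (\<sigma> s)) \<le> (\<Sum>s\<in>{1..N+1}. real (n (\<sigma> s)) * E (\<sigma> s))"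
      proof (rule sum_mono2)
        fix s assume "s \<in> {1..N+1} - {1..t}"
        then have "\<sigma> s \<in> {1..N+1}" using \<sigma> by (auto simp: bij_betw_def)
        then show "0 \<le> real (n (\<sigma> s)) * E (\<sigma> s)" using E(1) by simp
      qed (use t in auto)
      also have "\<dots> = (\<Sum>s\<in>{1..N+1}. real (n s) * E s)"
        by (rule sum.reindex_bij_betw[OF \<sigma>])
      also have "\<dots> \<le> B" unfolding B_def by (rule total)
      finally have "x powr a \<le> B / T" using T by (simp add: divide_right_mono)
      then have "(x powr a) powr (1 / a) \<le> (B / T) powr (1 / a)"
        using \<open>0 < a\<close> by (intro powr_mono2) auto
      then have "x \<le> (B / T) powr (1 / a)" using x(1) \<open>0 < a\<close> by (simp add: powr_powr)
      then show ?thesis unfolding rate_a using C\<rho> by (simp add: x_def field_simps)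
    qed
  qed
qed

section \<open>Change of minimiser, and assembly for the multisource class\<close>

lemma excess_risk_eq:
  assumes "is_arg_min (risk P) (\<lambda>h. h \<in> H) hs"
  shows "excess_risk H P h = risk P h - risk P hs"
proof -
  have "(INF h'\<in>H. risk P h') = risk P hs"
    using assms by (intro cInf_eq_minimum) (auto simp: is_arg_min_def not_less)
  then show ?thesis by (simp add: excess_risk_def)
qed

lemma disagreement_triangle:
  assumes P: "prob_space P" "sets P = sets (labelled X)"
    and h: "f \<in> measurable X (count_space labels)" "g \<in> measurable X (count_space labels)"
      "h \<in> measurable X (count_space labels)"
  shows "disagreement X P f h \<le> disagreement X P f g + disagreement X P h g"
proof -
  have "fst \<in> measurable P X" unfolding measurable_cong_sets[OF P(2) refl] by measurable
  then interpret D: prob_space "distr P X fst" by (rule prob_space.prob_space_distr[OF P(1)])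
  have ms: "{x \<in> space X. u x \<noteq> v x} \<in> D.events"
    if "u \<in> measurable X (count_space labels)" "v \<in> measurable X (count_space labels)" for u v
    using neq_measurable[OF that] by simp
  have "disagreement X P f h \<le> measure (distr P X fst) ({x \<in> space X. f x \<noteq> g x} \<union> {x \<in> space X. h x \<noteq> g x})"
    unfolding disagreement_def by (intro D.finite_measure_mono sets.Un ms h) auto
  also have "\<dots> \<le> disagreement X P f g + disagreement X P h g"
    unfolding disagreement_def by (intro measure_Un_le ms h)
  finally show ?thesis .
qed

text \<open>The minimiser in \<open>bernstein_class\<close> is existential and may differ from the
  common one. Both have excess risk 0, so the condition makes their disagreement 0, and the triangle
  inequality exchanges them at no cost in \<open>C\<close>.\<close>

lemma bernstein_class_arg_min:
  assumes P: "prob_space P" "sets P = sets (labelled X)"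
    and H: "H \<subseteq> measurable X (count_space labels)"
    and bern: "bernstein_class X H P C 1" and hs: "is_arg_min (risk P) (\<lambda>h. h \<in> H) hs" and h: "h \<in> H"
  shows "disagreement X P h hs \<le> C * (risk P h - risk P hs)"
proof -
  obtain hs' where hs': "is_arg_min (risk P) (\<lambda>h. h \<in> H) hs'"
    and dis: "\<And>h. h \<in> H \<Longrightarrow> disagreement X P h hs' \<le> C * rpow (excess_risk H P h) 1"
    using bern by (auto simp: bernstein_class_def)
  have in_H: "hs \<in> H" "hs' \<in> H" using hs hs' by (auto simp: is_arg_min_def)
  have "rpow (excess_risk H P g) 1 = risk P g - risk P hs" if "g \<in> H" for g
    using hs that by (simp add: excess_risk_eq[OF hs] rpow_def is_arg_min_def not_less)
  then have dis': "disagreement X P g hs' \<le> C * (risk P g - risk P hs)" if "g \<in> H" for g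
    using dis[OF that] that by simp
  have "disagreement X P h hs \<le> disagreement X P h hs' + disagreement X P hs hs'"
    using H h in_H by (intro disagreement_triangle[OF P]) auto
  then show ?thesis using dis'[OF h] dis'[OF in_H(1)] by simp
qed

lemma multisource_erm_bound:
  fixes X :: "'x measure"
  assumes cls: "classifier_class X H" and vc: "vc_dim X H = enat d" and \<rho>: "\<rho> (N + 1) = 1"
    and P: "P \<in> multisource_class X H N C\<rho> \<rho> n C\<beta> 1" and \<sigma>: "sorting_perm N \<rho> \<sigma>"
    and erm: "\<forall>z\<in>space (sample_law N n P). is_erm H (sample_index N n) z (hhat z)"
    and \<delta>: "0 < \<delta>" "\<delta> < 1"
  shows "with_prob_at_least (sample_law N n P) (1 - \<delta>) (\<lambda>z.
      ereal (excess_risk H (P (N + 1)) (hhat z)) \<le> (MIN t\<in>{1..N + 1}. rate 400 d \<delta> N C\<rho> \<rho> n C\<beta> \<sigma> t))"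
proof -
  define I where "I = sample_index N n"
  \<comment> \<open>The locales ask for a probability space at every index, also outside the sample,
    so \<open>P\<close> is continued by \<open>P 1\<close>.\<close>
  define P' where "P' t = (if t \<in> {1..N+1} then P t else P 1)" for t
  define M where "M i = P' (fst i)" for i :: "nat \<times> nat"
  have const_ge: "2 \<le> C\<rho>" "2 \<le> C\<beta>" and src: "\<And>t. t \<in> {1..N} \<Longrightarrow> 1 \<le> n t" "\<And>t. t \<in> {1..N} \<Longrightarrow> 0 < \<rho> t"
    and pr: "\<And>t. t \<in> {1..N+1} \<Longrightarrow> prob_space (P t)"
    and sets_P: "\<And>t. t \<in> {1..N+1} \<Longrightarrow> sets (P t) = sets (labelled X)"
    and tr: "\<And>t. t \<in> {1..N} \<Longrightarrow> transfer_exponent H (P t) (P (N+1)) C\<rho> (\<rho> t)"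
    and bern: "\<And>t. t \<in> {1..N+1} \<Longrightarrow> bernstein_class X H (P t) C\<beta> 1"
    using P unfolding multisource_class_def by blast+
  obtain hs where hs: "\<And>t. t \<in> {1..N+1} \<Longrightarrow> is_arg_min (risk (P t)) (\<lambda>h. h \<in> H) hs"
    using P unfolding multisource_class_def by blast
  have hs_H: "hs \<in> H" using hs[of 1] by (simp add: is_arg_min_def)
  have P'_eq: "\<exists>s\<in>{1..N+1}. P' t = P s" for t by (cases "t \<in> {1..N+1}") (auto simp: P'_def)
  have Hm: "H \<subseteq> measurable X (count_space labels)" using cls by (auto simp: classifier_class_def)
  have law: "sample_law N n P = PiM I M"
    unfolding sample_law_def I_def by (rule PiM_cong) (auto simp: sample_index_def M_def P'_def)
  have fin: "finite I" by (simp add: I_def sample_index_def)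
  have card_I: "card I = (\<Sum>s\<in>{1..N+1}. n s)"
    by (simp add: I_def sample_index_def card_SigmaI)
  have prob_M: "prob_space (M i)" for i using P'_eq[of "fst i"] pr by (auto simp: M_def)
  have excess: "excess_risk H (P t) h = risk (P t) h - risk (P t) hs" if "t \<in> {1..N+1}" for t h
    by (rule excess_risk_eq[OF hs[OF that]])
  have nonneg: "0 \<le> excess_risk H (P t) h" if "t \<in> {1..N+1}" "h \<in> H" for t h
    using hs[OF that(1)] that(2) by (simp add: excess[OF that(1)] is_arg_min_def not_less)
  have le1: "excess_risk H (P (N + 1)) h \<le> 1" for h
  proof -
    interpret D: prob_space "P (N + 1)" by (rule pr) simp
    show ?thesis
      using D.prob_le_1[of "{z \<in> space (P (N + 1)). h (fst z) \<noteq> snd z}"]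
        measure_nonneg[of "P (N + 1)" "{z \<in> space (P (N + 1)). hs (fst z) \<noteq> snd z}"]
        excess[of "N + 1" h, simplified]
      unfolding risk_def Suc_eq_plus1 by linarith
  qed
  show ?thesis
  proof (cases "I = {}")
    case True
    \<comment> \<open>No data at all: every denominator vanishes and each rate is infinite.\<close>
    then have n0: "n s = 0" if "s \<in> {1..N+1}" for s
      using card_I that by (simp del: sum.cl_ivl_Suc)
    have bij: "bij_betw \<sigma> {1..N+1} {1..N+1}" using \<sigma> by (simp add: sorting_perm_def)
    have "rate 400 d \<delta> N C\<rho> \<rho> n C\<beta> \<sigma> t = \<infinity>" if "t \<in> {1..N+1}" for t
    proof -
      have "n (\<sigma> s) = 0" if s: "s \<in> {1..t}" for s
      proof (rule n0)
        show "\<sigma> s \<in> {1..N+1}" using bij s \<open>t \<in> {1..N+1}\<close> unfolding bij_betw_def by auto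
      qed
      then have "(\<Sum>s\<in>{1..t}. n (\<sigma> s)) = 0" by (rule sum.neutral[OF ballI])
      then show ?thesis unfolding rate_def by simp
    qed
    then have "(MIN t\<in>{1..N + 1}. rate 400 d \<delta> N C\<rho> \<rho> n C\<beta> \<sigma> t) = \<infinity>" by simp
    moreover have "prob_space (PiM I M)" by (rule prob_space_PiM[OF prob_M])
    ultimately show ?thesis
      unfolding with_prob_at_least_def law using \<delta>
      by (intro bexI[of _ "space (PiM I M)"]) (auto simp: prob_space.prob_space)
  next
    case False
    interpret erm_sample I M X H d hs C\<beta>
    proof (intro erm_sample.intro erm_sample_axioms.intro finite_sample.intro)
      show "prob_space (M i)" for i by (rule prob_M)
      show "sets (M i) = sets (labelled X)" for i using P'_eq[of "fst i"] sets_P by (auto simp: M_def)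
      show "disagreement X (M i) h hs \<le> C\<beta> * (risk (M i) h - risk (M i) hs)" if "h \<in> H" for i h
      proof -
        obtain s where "s \<in> {1..N+1}" "M i = P s" using P'_eq[of "fst i"] by (auto simp: M_def)
        then show ?thesis using bernstein_class_arg_min[OF pr sets_P Hm bern hs that] by simp
      qed
    qed (use cls vc hs_H const_ge fin False in auto)
    obtain A where A: "A \<in> sets (PiM I M)" "1 - \<delta> \<le> measure (PiM I M) A"
      and bd: "\<And>z h. z \<in> A \<Longrightarrow> h \<in> H \<Longrightarrow> empirical_risk I z h \<le> empirical_risk I z hs \<Longrightarrow>
       (\<Sum>i\<in>I. risk (M i) h - risk (M i) hs)
         \<le> 400 * C\<beta> * (real d * log1 (real (card I) / real d) + log1 (1 / \<delta>))"
      using erm_cumulative_bound[OF \<delta>] by blast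
    show ?thesis
      unfolding with_prob_at_least_def law
    proof (intro bexI[OF _ A(1)] conjI ballI A(2))
      fix z assume z: "z \<in> A"
      then have "is_erm H I z (hhat z)"
        using erm sets.sets_into_space[OF A(1)] by (auto simp: law I_def)
      then have hH: "hhat z \<in> H" and "empirical_risk I z (hhat z) \<le> empirical_risk I z hs"
        using hs_H by (auto simp: is_erm_def is_arg_min_def not_less)
      from bd[OF z this] have le: "(\<Sum>i\<in>I. risk (M i) (hhat z) - risk (M i) hs)
         \<le> 400 * C\<beta> * (real d * log1 (real (card I) / real d) + log1 (1 / \<delta>))" .
      let ?E = "\<lambda>t. excess_risk H (P t) (hhat z)"
      have "(\<Sum>i\<in>I. risk (M i) (hhat z) - risk (M i) hs) = (\<Sum>i\<in>I. ?E (fst i))"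
        by (intro sum.cong) (auto simp: I_def sample_index_def M_def P'_def excess)
      also have "\<dots> = (\<Sum>t\<in>{1..N+1}. \<Sum>j\<in>{1..n t}. ?E t)"
        unfolding I_def sample_index_def by (subst sum.Sigma) (auto simp: split_beta)
      also have "\<dots> = (\<Sum>t\<in>{1..N+1}. real (n t) * ?E t)" by simp
      finally have total: "(\<Sum>t\<in>{1..N+1}. real (n t) * ?E t) \<le>
        400 * C\<beta> * (real d * log1 (1 / real d * real (\<Sum>s\<in>{1..N+1}. n s)) + log1 (1 / \<delta>))"
        using le unfolding card_I by simp
      \<comment> \<open>The event \<open>A\<close> was fixed before \<open>t\<close>, so all terms
        of the minimum hold on it simultaneously.\<close>
      have "ereal (?E (N + 1)) \<le> rate 400 d \<delta> N C\<rho> \<rho> n C\<beta> \<sigma> t" if "t \<in> {1..N+1}" for t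
      proof (rule rate_bound[where E = ?E and N = N and n = n and \<rho> = \<rho> and c = 400 and C\<beta> = C\<beta> and d = d and \<delta> = \<delta>, OF _ le1 const_ge(1) \<rho> src _ total _ that])
        show "0 \<le> ?E s" if "s \<in> {1..N+1}" for s by (rule nonneg[OF that hH])
        show "?E (N + 1) \<le> C\<rho> * rpow (?E s) (real_of_ereal (1 / \<rho> s))" if "s \<in> {1..N}" for s
          using tr[OF that] hH by (simp add: transfer_exponent_def)
        show "bij_betw \<sigma> {1..N+1} {1..N+1}" using \<sigma> by (simp add: sorting_perm_def)
      qed
      then show "ereal (?E (N + 1)) \<le> (MIN t\<in>{1..N + 1}. rate 400 d \<delta> N C\<rho> \<rho> n C\<beta> \<sigma> t)"
        by (intro Min.boundedI) auto
    qed
  qed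
qed

theorem theorem3:
  shows "\<exists>c>0. \<forall>(X :: 'x measure) H d N C\<rho> \<rho> n C\<beta> \<beta> P \<sigma> hhat \<delta>.
    classifier_class X H \<longrightarrow> vc_dim X H = enat d \<longrightarrow>
    \<beta> = 1 \<longrightarrow> \<rho> (N + 1) = 1 \<longrightarrow> P \<in> multisource_class X H N C\<rho> \<rho> n C\<beta> \<beta> \<longrightarrow>
    sorting_perm N \<rho> \<sigma> \<longrightarrow>
    (\<forall>z\<in>space (sample_law N n P). is_erm H (sample_index N n) z (hhat z)) \<longrightarrow>
    0 < \<delta> \<longrightarrow> \<delta> < 1 \<longrightarrow>
    with_prob_at_least (sample_law N n P) (1 - \<delta>) (\<lambda>z.
      ereal (excess_risk H (P (N + 1)) (hhat z))
        \<le> (MIN t\<in>{1..N + 1}. rate c d \<delta> N C\<rho> \<rho> n C\<beta> \<sigma> t))"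
proof (intro exI[of _ 400] conjI allI impI)
  fix X :: "'x measure" and H d N C\<rho> \<rho> n C\<beta> P \<sigma> hhat and \<delta> \<beta> :: real
  assume "\<beta> = 1" and P: "P \<in> multisource_class X H N C\<rho> \<rho> n C\<beta> \<beta>"
    and rest: "classifier_class X H" "vc_dim X H = enat d" "\<rho> (N + 1) = 1" "sorting_perm N \<rho> \<sigma>"
      "\<forall>z\<in>space (sample_law N n P). is_erm H (sample_index N n) z (hhat z)" "0 < \<delta>" "\<delta> < 1"
  have "P \<in> multisource_class X H N C\<rho> \<rho> n C\<beta> 1" using P unfolding \<open>\<beta> = 1\<close> .
  from multisource_erm_bound[OF rest(1-3) this rest(4-)]
  show "with_prob_at_least (sample_law N n P) (1 - \<delta>) (\<lambda>z.
      ereal (excess_risk H (P (N + 1)) (hhat z)) \<le> (MIN t\<in>{1..N + 1}. rate 400 d \<delta> N C\<rho> \<rho> n C\<beta> \<sigma> t))" .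
qed simp

end
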